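(* Let $H$ be a Krull monoid, and write $H=H^\times\times\mathcal F(P_0)\times H^*$, where $P_0$ is a set of representatives (up to associates) of the prime elements of $H$, $\mathcal F(P_0)\times H^*\cong H_{\mathrm{red}}$, and $H^*$ is a reduced Krull monoid without prime elements. 1. If $H$ satisfies the approximation property, then $H$ is length-factorial if and only if it is factorial. 2. Suppose that every nonzero class of $\mathcal C(H)$ contains a prime divisor. Then $H$ is length-factorial if and only if $H^* \cong \mathcal B ( \mathcal C (H) \setminus \{0\})$ and ($|\mathcal C (H)| \le 3$ or $\mathcal C (H)$ is an elementary $2$-group of rank two).
   Context: A monoid means a commutative semigroup with identity that is unit-cancellative ($a=au$ implies that $u$ is invertible). For a monoid $H$: $H^\times$ is its group of invertible elements; $H$ is reduced if $H^\times=\{1\}$; $H_{\mathrm{red}}=\{aH^\times : a\in H\}$. An element $u\notin H^\times$ is prime if $u\mid ab$ implies $u\mid a$ or $u\mid b$; it is an atom if $u=ab$ implies $a\in H^\times$ or $b\in H^\times$. $\mathcal F(P)$ is the free abelian monoid with basis $P$, and $\mathsf v_p$ denotes the exponent of $p\in P$. The factorization monoid is $\mathsf Z(H)=\mathcal F(\mathcal A(H_{\mathrm{red}}))$, where $\mathcal A(\cdot)$ is the set of atoms. Factorizations of $a\in H$ are the $z\in\mathsf Z(H)$ with product $aH^\times$ in $H_{\mathrm{red}}$; the length of $z$ is its number of atoms counted with multiplicity. $H$ is atomic if every element has a factorization, factorial if every element has exactly one, and length-factorial if it is atomic and any two distinct factorizations of any element have distinct lengths. A monoid homomorphism $\varphi\colon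 H\to D$ is a divisor homomorphism if $\varphi(a)\mid\varphi(b)$ in $D$ implies $a\mid b$ in $H$. It is a divisor theory if moreover $D$ is free abelian and every $a\in D$ is of the form $\gcd(\varphi(a_1),\ldots,\varphi(a_m))$ with $a_1,\ldots,a_m\in H$. A Krull monoid is a cancellative monoid having a divisor theory. If $H$ is Krull with divisor theory $H_{\mathrm{red}}\hookrightarrow F=\mathcal F(P)$ (unique up to isomorphism), its class group is $\mathcal C(H)=\mathsf q(F)/\mathsf q(H_{\mathrm{red}})$ (quotient groups), written additively. The elements of $P$ are the prime divisors, and $p\in P$ lies in the class $[p]=p\,\mathsf q(H_{\mathrm{red}})$. $H$ satisfies the approximation property if one of the following equivalent conditions holds. (a) For all $n\in\mathbb N$ and distinct $p,p_1,\ldots,p_n\in P$ there is some $a\in H$ with $\mathsf v_p(a)=1$ and $\mathsf v_{p_i}(a)=0$ for all $i\in[1,n]$ (where $a$ is identified with $aH^\times\in\mathcal F(P)$). (b) For all $a,b\in F$ there is $c\in F$ such that $[a]=[c]$ and $\gcd(b,c)=1$. For an additive abelian group $G$ and $G_0\subset G$, $\mathcal B(G_0)=\{S=g_1\cdot\ldots\cdot g_\ell\in\mathcal F(G_0): g_1+\ldots+g_\ell=0\}$ is the monoid of zero-sum sequences over $G_0$. *)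

theory Defs
  imports "HOL-Algebra.Divisibility" "HOL-Algebra.Free_Abelian_Groups"
    "HOL-Algebra.Elementary_Groups"
begin

section \<open>Free abelian monoids and products of multisets\<close>

text \<open>\<open>\<F>(P)\<close>: multisets with support in \<open>P\<close>; the exponent \<open>v\<^sub>p(M)\<close> is \<open>count M p\<close>.\<close>

definition free_monoid :: "'p set \<Rightarrow> 'p multiset monoid" where
  "free_monoid P = \<lparr>carrier = {M. set_mset M \<subseteq> P}, monoid.mult = (+), one = {#}\<rparr>"

definition free_abelian_monoid :: "('d, 'n) monoid_scheme \<Rightarrow> bool" where
  "free_abelian_monoid D \<longleftrightarrow> (\<exists>P :: 'd set. D \<cong> free_monoid P)"

definition mset_prod :: "('a, 'm) monoid_scheme \<Rightarrow> 'a multiset \<Rightarrow> 'a" where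
  "mset_prod G M = (\<Otimes>\<^bsub>G\<^esub>x\<in>set_mset M. x [^]\<^bsub>G\<^esub> count M x)"


section \<open>Factorizations\<close>

definition reduced :: "('a, 'm) monoid_scheme \<Rightarrow> bool" where
  "reduced H \<longleftrightarrow> Units H = {\<one>\<^bsub>H\<^esub>}"

definition red :: "('a, 'm) monoid_scheme \<Rightarrow> 'a set monoid" where
  "red H = \<lparr>carrier = (\<lambda>a. a <#\<^bsub>H\<^esub> Units H) ` carrier H,
            monoid.mult = set_mult H, one = Units H\<rparr>"

text \<open>In a unit-cancellative commutative monoid, \<^const>\<open>irreducible\<close> (every proper divisor is a
  unit) says exactly that \<open>u = a b\<close> forces \<open>a\<close> or \<open>b\<close> to be a unit.\<close>

definition atoms :: "('a, 'm) monoid_scheme \<Rightarrow> 'a set" where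
  "atoms H = {u \<in> carrier H. irreducible H u}"

definition factorization_monoid :: "('a, 'm) monoid_scheme \<Rightarrow> 'a set multiset monoid" where
  "factorization_monoid H = free_monoid (atoms (red H))"

definition factorizations :: "('a, 'm) monoid_scheme \<Rightarrow> 'a \<Rightarrow> 'a set multiset set" where
  "factorizations H a =
     {z \<in> carrier (factorization_monoid H). mset_prod (red H) z = a <#\<^bsub>H\<^esub> Units H}"

definition atomic :: "('a, 'm) monoid_scheme \<Rightarrow> bool" where
  "atomic H \<longleftrightarrow> (\<forall>a\<in>carrier H. factorizations H a \<noteq> {})"

definition factorial :: "('a, 'm) monoid_scheme \<Rightarrow> bool" where
  "factorial H \<longleftrightarrow> (\<forall>a\<in>carrier H. \<exists>!z. z \<in> factorizations H a)"

definition length_factorial :: "('a, 'm) monoid_scheme \<Rightarrow> bool" where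
  "length_factorial H \<longleftrightarrow> atomic H \<and>
     (\<forall>a\<in>carrier H. \<forall>z\<in>factorizations H a. \<forall>z'\<in>factorizations H a.
        z \<noteq> z' \<longrightarrow> size z \<noteq> size z')"


section \<open>Krull monoids\<close>

definition divisor_hom ::
  "('a, 'm) monoid_scheme \<Rightarrow> ('d, 'n) monoid_scheme \<Rightarrow> ('a \<Rightarrow> 'd) \<Rightarrow> bool" where
  "divisor_hom H D \<phi> \<longleftrightarrow> \<phi> \<in> hom H D \<and> \<phi> \<one>\<^bsub>H\<^esub> = \<one>\<^bsub>D\<^esub> \<and>
     (\<forall>a\<in>carrier H. \<forall>b\<in>carrier H. \<phi> a divides\<^bsub>D\<^esub> \<phi> b \<longrightarrow> a divides\<^bsub>H\<^esub> b)"

definition is_gcd_of :: "('d, 'n) monoid_scheme \<Rightarrow> 'd \<Rightarrow> 'd set \<Rightarrow> bool" where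
  "is_gcd_of D d A \<longleftrightarrow> d \<in> carrier D \<and> (\<forall>x\<in>A. d divides\<^bsub>D\<^esub> x) \<and>
     (\<forall>y\<in>carrier D. (\<forall>x\<in>A. y divides\<^bsub>D\<^esub> x) \<longrightarrow> y divides\<^bsub>D\<^esub> d)"

definition divisor_theory ::
  "('a, 'm) monoid_scheme \<Rightarrow> ('d, 'n) monoid_scheme \<Rightarrow> ('a \<Rightarrow> 'd) \<Rightarrow> bool" where
  "divisor_theory H D \<phi> \<longleftrightarrow> divisor_hom H D \<phi> \<and> free_abelian_monoid D \<and>
     (\<forall>d\<in>carrier D. \<exists>A. A \<subseteq> carrier H \<and> finite A \<and> A \<noteq> {} \<and> is_gcd_of D d (\<phi> ` A))"

text \<open>The existential has to fix a type for the free abelian monoid. Taking multisets over the type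
  of \<open>H\<close> loses nothing: in a divisor theory \<open>H \<rightarrow> \<F>(P)\<close> every \<open>p \<in> P\<close> divides the image of some
  element of \<open>H\<close>, and \<open>H\<close> is infinite unless \<open>P\<close> is empty, so \<open>P\<close> has at most as many elements
  as \<open>H\<close>.\<close>

definition krull_monoid :: "('a, 'm) monoid_scheme \<Rightarrow> bool" where
  "krull_monoid H \<longleftrightarrow> comm_monoid_cancel H \<and>
     (\<exists>(D :: 'a multiset monoid) \<phi>. divisor_theory H D \<phi>)"


section \<open>Class group and approximation property\<close>

text \<open>In this section \<open>\<phi>\<close> is a divisor theory from \<open>red H\<close> to \<open>\<F>(P)\<close>. The quotient group of
  \<open>\<F>(P)\<close> is \<open>free_Abelian_group P\<close>, into which \<open>\<F>(P)\<close> embeds by \<open>to_frag\<close>.\<close>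

definition to_frag :: "'p multiset \<Rightarrow> ('p \<Rightarrow>\<^sub>0 int)" where
  "to_frag M = (\<Sum>p\<in>#M. frag_of p)"

definition principal_group ::
  "('a, 'm) monoid_scheme \<Rightarrow> ('a set \<Rightarrow> 'p multiset) \<Rightarrow> ('p \<Rightarrow>\<^sub>0 int) set" where
  "principal_group H \<phi> =
     {to_frag (\<phi> a) - to_frag (\<phi> b) | a b. a \<in> carrier (red H) \<and> b \<in> carrier (red H)}"

definition class_group ::
  "('a, 'm) monoid_scheme \<Rightarrow> 'p set \<Rightarrow> ('a set \<Rightarrow> 'p multiset) \<Rightarrow> ('p \<Rightarrow>\<^sub>0 int) set monoid" where
  "class_group H P \<phi> = free_Abelian_group P Mod principal_group H \<phi>"

definition prime_class ::
  "('a, 'm) monoid_scheme \<Rightarrow> 'p set \<Rightarrow> ('a set \<Rightarrow> 'p multiset) \<Rightarrow> 'p \<Rightarrow> ('p \<Rightarrow>\<^sub>0 int) set" where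
  "prime_class H P \<phi> p = principal_group H \<phi> #>\<^bsub>free_Abelian_group P\<^esub> frag_of p"

text \<open>\<open>Q\<close> plays the role of \<open>{p\<^sub>1, \<dots>, p\<^sub>n}\<close>; the case \<open>Q = {}\<close> holds for every divisor theory,
  since \<open>p\<close> is the gcd of images of elements of \<open>H\<close>.\<close>

definition approximation_property ::
  "('a, 'm) monoid_scheme \<Rightarrow> 'p set \<Rightarrow> ('a set \<Rightarrow> 'p multiset) \<Rightarrow> bool" where
  "approximation_property H P \<phi> \<longleftrightarrow>
     (\<forall>p\<in>P. \<forall>Q. finite Q \<and> Q \<subseteq> P \<and> p \<notin> Q \<longrightarrow>
        (\<exists>a\<in>carrier H. count (\<phi> (a <#\<^bsub>H\<^esub> Units H)) p = 1 \<and>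
           (\<forall>q\<in>Q. count (\<phi> (a <#\<^bsub>H\<^esub> Units H)) q = 0)))"


section \<open>Splitting off units and primes\<close>

text \<open>The decomposition \<open>H = H\<^sup>\<times> \<times> \<F>(P\<^sub>0) \<times> H\<^sup>*\<close> is internal: \<open>P\<^sub>0\<close> and \<open>H\<^sup>*\<close> are subsets of \<open>H\<close>,
  and multiplication in \<open>H\<close> is an isomorphism from the product of the three factors.\<close>

definition prime_decomposition ::
  "('a, 'm) monoid_scheme \<Rightarrow> 'a set \<Rightarrow> 'a set \<Rightarrow> bool" where
  "prime_decomposition H P0 Hs \<longleftrightarrow>
     (\<forall>p\<in>P0. p \<in> carrier H \<and> prime H p) \<and>
     (\<forall>q\<in>carrier H. prime H q \<longrightarrow> (\<exists>!p. p \<in> P0 \<and> p \<sim>\<^bsub>H\<^esub> q)) \<and>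
     submonoid Hs H \<and>
     (\<lambda>(u, f, h). u \<otimes>\<^bsub>H\<^esub> mset_prod H f \<otimes>\<^bsub>H\<^esub> h)
        \<in> iso (units_of H \<times>\<times> free_monoid P0 \<times>\<times> H\<lparr>carrier := Hs\<rparr>) H \<and>
     (free_monoid P0 \<times>\<times> H\<lparr>carrier := Hs\<rparr>) \<cong> red H \<and>
     reduced (H\<lparr>carrier := Hs\<rparr>) \<and> krull_monoid (H\<lparr>carrier := Hs\<rparr>) \<and>
     (\<forall>q\<in>Hs. \<not> prime (H\<lparr>carrier := Hs\<rparr>) q)"


section \<open>Zero-sum sequences\<close>

text \<open>The abelian group \<open>G\<close> is written multiplicatively, so that zero-sum sequences are the
  multisets whose product is \<open>\<one>\<close>.\<close>

definition zero_sum_monoid :: "('g, 'm) monoid_scheme \<Rightarrow> 'g set \<Rightarrow> 'g multiset monoid" where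
  "zero_sum_monoid G G0 =
     \<lparr>carrier = {S. set_mset S \<subseteq> G0 \<and> mset_prod G S = \<one>\<^bsub>G\<^esub>}, monoid.mult = (+), one = {#}\<rparr>"

definition elementary_2_group_rank_two :: "('g, 'm) monoid_scheme \<Rightarrow> bool" where
  "elementary_2_group_rank_two G \<longleftrightarrow> G \<cong> integer_mod_group 2 \<times>\<times> integer_mod_group 2"

end

theory Submission
  imports Defs
begin

text \<open>A divisor theory identifies \<open>H\<^sub>r\<^sub>e\<^sub>d\<close> with a submonoid \<open>M\<close> of \<open>\<F>(P)\<close>, namely the sequences over
  \<open>P\<close> whose classes sum to zero. In a length-factorial monoid two relations between atoms can be
  combined, with suitable multiplicities, to one with equal lengths on both sides; so all relations
  are rational multiples of one another, and only the finitely many atoms of one relation fail to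
  be prime.

  Under the approximation property, let \<open>u\<close> be an atom of a non-trivial relation and \<open>p\<close> a prime
  divisor of \<open>u\<close>. There is an atom \<open>w\<close> containing \<open>p\<close> exactly once and no other prime divisor of the
  relation; it is prime in \<open>M\<close>. An element \<open>b\<close> of \<open>M\<close> divisible by \<open>w - p\<close> but not by \<open>p\<close> makes
  \<open>w\<close> divide \<open>u + b\<close>, but \<open>w\<close> divides neither \<open>u\<close> nor \<open>b\<close>.

  If every non-zero class contains a prime divisor, then comparing relations forces exactly one
  prime divisor in each non-zero class, and comparing
  \<open>(g, h, -(g + h)) + (-g, -h, g + h) = (g, -g) + (h, -h) + (g + h, -(g + h))\<close>
  for different \<open>g\<close> and \<open>h\<close> leaves only the class groups of the theorem.\<close>

section \<open>Products of multisets\<close>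

context comm_monoid
begin

text \<open>Elements outside the multiset have exponent 0, so products of several multisets can be
  compared over one common index set.\<close>

lemma mset_prod_superset:
  assumes "finite S" "set_mset M \<subseteq> S" "S \<subseteq> carrier G"
  shows "mset_prod G M = (\<Otimes>x\<in>S. x [^] count M x)"
  unfolding mset_prod_def
  by (rule finprod_mono_neutral_cong_left) (use assms in \<open>auto simp: not_in_iff\<close>)

lemma mset_prod_closed [simp, intro]:
  "set_mset M \<subseteq> carrier G \<Longrightarrow> mset_prod G M \<in> carrier G"
  unfolding mset_prod_def by (intro finprod_closed) auto

lemma mset_prod_add:
  assumes "set_mset M \<subseteq> carrier G" "set_mset N \<subseteq> carrier G"
  shows "mset_prod G (M + N) = mset_prod G M \<otimes> mset_prod G N"
proof -
  let ?S = "set_mset (M + N)"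
  have "mset_prod G K = (\<Otimes>x\<in>?S. x [^] count K x)" if "K \<in> {M, N, M + N}" for K
    using that assms by (intro mset_prod_superset) auto
  moreover have "(\<Otimes>x\<in>?S. x [^] count (M + N) x)
      = (\<Otimes>x\<in>?S. x [^] count M x \<otimes> x [^] count N x)"
    using assms by (intro finprod_cong) (auto simp: nat_pow_mult simp_implies_def)
  ultimately show ?thesis
    using assms by (subst (asm) finprod_multf) auto
qed

lemma mset_prod_empty [simp]: "mset_prod G {#} = \<one>"
  by (simp add: mset_prod_def)

lemma mset_prod_single [simp]: "x \<in> carrier G \<Longrightarrow> mset_prod G {#x#} = x"
  by (simp add: mset_prod_def)

lemma mset_prod_add_mset [simp]:
  "x \<in> carrier G \<Longrightarrow> set_mset M \<subseteq> carrier G \<Longrightarrow> mset_prod G (add_mset x M) = x \<otimes> mset_prod G M"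
  using mset_prod_add[of "{#x#}" M] by simp

end

lemma (in comm_monoid) Units_iff:
  "x \<in> Units G \<longleftrightarrow> x \<in> carrier G \<and> (\<exists>y\<in>carrier G. x \<otimes> y = \<one>)"
  unfolding Units_def using m_comm by fastforce

lemma hom_mset_prod:
  assumes "comm_monoid G" "comm_monoid G'" "f \<in> hom G G'" "f \<one>\<^bsub>G\<^esub> = \<one>\<^bsub>G'\<^esub>"
    and "set_mset M \<subseteq> carrier G"
  shows "f (mset_prod G M) = mset_prod G' (image_mset f M)"
proof -
  interpret G: comm_monoid G by fact
  interpret G': comm_monoid G' by fact
  show ?thesis
    using assms(5)
  proof (induction M)
    case (add x M)
    have c: "set_mset (image_mset f M) \<subseteq> carrier G'" "f x \<in> carrier G'"
      using add.prems assms(3) by (auto simp: hom_def)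
    have "f (mset_prod G (add_mset x M)) = f x \<otimes>\<^bsub>G'\<^esub> f (mset_prod G M)"
      using add.prems by (simp add: hom_mult[OF assms(3)] )
    also have "\<dots> = f x \<otimes>\<^bsub>G'\<^esub> mset_prod G' (image_mset f M)"
      using add by simp
    also have "\<dots> = mset_prod G' (image_mset f (add_mset x M))"
      using G'.mset_prod_add_mset[OF c(2,1)] by simp
    finally show ?case .
  qed (simp add: assms(4))
qed

lemma image_mset_inj_on:
  assumes "inj_on f A" "set_mset y \<subseteq> A" "set_mset y' \<subseteq> A" "image_mset f y = image_mset f y'"
  shows "y = y'"
proof -
  let ?g = "inv_into A f"
  have inv: "image_mset ?g (image_mset f v) = v" if "set_mset v \<subseteq> A" for v
  proof -
    have "image_mset (\<lambda>x. ?g (f x)) v = image_mset (\<lambda>x. x) v"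
      by (rule image_mset_cong, rule inv_into_f_f[OF assms(1)], rule subsetD[OF that])
    then show ?thesis by (simp add: multiset.map_comp comp_def)
  qed
  have "y = image_mset ?g (image_mset f y)"
    by (rule inv[OF assms(2), symmetric])
  also have "\<dots> = image_mset ?g (image_mset f y')"
    by (rule arg_cong[OF assms(4)])
  also have "\<dots> = y'"
    by (rule inv[OF assms(3)])
  finally show ?thesis .
qed

lemma image_mset_surj_on:
  assumes "set_mset z \<subseteq> f ` A"
  obtains y where "set_mset y \<subseteq> A" "z = image_mset f y"
proof (rule that)
  let ?y = "image_mset (inv_into A f) z"
  show "set_mset ?y \<subseteq> A"
    unfolding set_image_mset by (rule image_subsetI, rule inv_into_into, rule subsetD[OF assms])
  have "image_mset (\<lambda>x. f (inv_into A f x)) z = image_mset (\<lambda>x. x) z"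
    by (rule image_mset_cong, rule f_inv_into_f, rule subsetD[OF assms])
  then show "z = image_mset f ?y" by (simp only: multiset.map_comp comp_def image_mset.id multiset.map_ident)
qed

section \<open>Unique factorization and isomorphisms\<close>

text \<open>With \<open>R\<close> the equality relation this expresses length-factoriality, with \<open>R\<close> total it
  expresses factoriality (both up to atomicity).\<close>

definition unique_factorizations ::
  "(nat \<Rightarrow> nat \<Rightarrow> bool) \<Rightarrow> ('a, 'm) monoid_scheme \<Rightarrow> bool" where
  "unique_factorizations R G \<longleftrightarrow>
     (\<forall>z z'. set_mset z \<subseteq> atoms G \<longrightarrow> set_mset z' \<subseteq> atoms G \<longrightarrow>
        mset_prod G z = mset_prod G z' \<longrightarrow> R (size z) (size z') \<longrightarrow> z = z')"

lemma unique_factorizationsD: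
  assumes "unique_factorizations R G" "set_mset z \<subseteq> atoms G" "set_mset z' \<subseteq> atoms G"
    "mset_prod G z = mset_prod G z'" "R (size z) (size z')"
  shows "z = z'"
  using assms unfolding unique_factorizations_def by blast

lemma atoms_carrier: "atoms G \<subseteq> carrier G"
  by (auto simp: atoms_def)

locale monoid_iso = G: comm_monoid G + G': comm_monoid G'
  for G (structure) and G' (structure) +
  fixes f
  assumes iso: "f \<in> iso G G'"
begin

lemma f_hom: "f \<in> hom G G'"
  using iso by (simp add: iso_def)

lemma f_image: "f ` carrier G = carrier G'"
  using iso by (auto simp: iso_def bij_betw_def)

lemma f_closed [simp, intro]: "x \<in> carrier G \<Longrightarrow> f x \<in> carrier G'"
  using f_image by blast

lemma f_inj: "inj_on f (carrier G)"
  using iso by (auto simp: iso_def bij_betw_def)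

lemma f_eq_iff [simp]: "x \<in> carrier G \<Longrightarrow> y \<in> carrier G \<Longrightarrow> f x = f y \<longleftrightarrow> x = y"
  using f_inj by (auto simp: inj_on_def)

lemma f_mult: "x \<in> carrier G \<Longrightarrow> y \<in> carrier G \<Longrightarrow> f (x \<otimes>\<^bsub>G\<^esub> y) = f x \<otimes>\<^bsub>G'\<^esub> f y"
  using f_hom by (simp add: hom_def)

lemma f_one [simp]: "f \<one>\<^bsub>G\<^esub> = \<one>\<^bsub>G'\<^esub>"
proof -
  obtain x where x: "x \<in> carrier G" "f x = \<one>\<^bsub>G'\<^esub>"
    using f_image by (metis G'.one_closed imageE)
  then have "f (x \<otimes>\<^bsub>G\<^esub> \<one>\<^bsub>G\<^esub>) = f \<one>\<^bsub>G\<^esub>"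
    by (subst f_mult) auto
  with x show ?thesis by simp
qed

lemma f_Units: "x \<in> carrier G \<Longrightarrow> f x \<in> Units G' \<longleftrightarrow> x \<in> Units G"
proof -
  assume x: "x \<in> carrier G"
  have "f x \<in> Units G' \<longleftrightarrow> (\<exists>y\<in>f ` carrier G. f x \<otimes>\<^bsub>G'\<^esub> y = \<one>\<^bsub>G'\<^esub>)"
    using x unfolding f_image by (simp add: G'.Units_iff)
  also have "\<dots> \<longleftrightarrow> (\<exists>y\<in>carrier G. f (x \<otimes>\<^bsub>G\<^esub> y) = f \<one>\<^bsub>G\<^esub>)"
    using x by (simp add: f_mult)
  also have "\<dots> \<longleftrightarrow> (\<exists>y\<in>carrier G. x \<otimes>\<^bsub>G\<^esub> y = \<one>\<^bsub>G\<^esub>)"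
    using x by (intro bex_cong refl f_eq_iff) auto
  also have "\<dots> \<longleftrightarrow> x \<in> Units G"
    using x by (simp add: G.Units_iff)
  finally show ?thesis .
qed

lemma f_divides:
  assumes "x \<in> carrier G" "y \<in> carrier G"
  shows "f x divides\<^bsub>G'\<^esub> f y \<longleftrightarrow> x divides\<^bsub>G\<^esub> y"
proof -
  have "f x divides\<^bsub>G'\<^esub> f y \<longleftrightarrow> (\<exists>c\<in>f ` carrier G. f y = f x \<otimes>\<^bsub>G'\<^esub> c)"
    unfolding f_image factor_def ..
  also have "\<dots> \<longleftrightarrow> (\<exists>c\<in>carrier G. f y = f (x \<otimes>\<^bsub>G\<^esub> c))"
    using assms by (simp add: f_mult)
  also have "\<dots> \<longleftrightarrow> (\<exists>c\<in>carrier G. y = x \<otimes>\<^bsub>G\<^esub> c)"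
    using assms by (intro bex_cong refl f_eq_iff) auto
  finally show ?thesis unfolding factor_def .
qed

lemma f_irreducible:
  assumes "x \<in> carrier G"
  shows "irreducible G' (f x) \<longleftrightarrow> irreducible G x"
proof -
  have "(\<forall>b\<in>carrier G'. properfactor G' b (f x) \<longrightarrow> b \<in> Units G') \<longleftrightarrow>
      (\<forall>b\<in>carrier G. properfactor G b x \<longrightarrow> b \<in> Units G)"
    unfolding f_image[symmetric] ball_simps
    by (intro ball_cong refl) (use assms in \<open>simp add: f_divides f_Units properfactor_def\<close>)
  with assms show ?thesis by (simp add: irreducible_def f_Units)
qed

lemma atoms_image: "atoms G' = f ` atoms G"
  unfolding atoms_def f_image[symmetric] using f_irreducible by auto

lemma f_mset_prod:
  "set_mset z \<subseteq> carrier G \<Longrightarrow> f (mset_prod G z) = mset_prod G' (image_mset f z)"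
  by (rule hom_mset_prod) (simp_all add: f_hom G.comm_monoid_axioms G'.comm_monoid_axioms)

text \<open>The isomorphism carries atoms to atoms, commutes with products and keeps the number of
  factors, so the equivalence holds for every relation \<open>R\<close> on lengths.\<close>

lemma unique_factorizations_iff:
  "unique_factorizations R G' \<longleftrightarrow> unique_factorizations R G"
proof
  assume L: "unique_factorizations R G'"
  show "unique_factorizations R G"
    unfolding unique_factorizations_def
  proof (intro allI impI)
    fix z z'
    assume *: "set_mset z \<subseteq> atoms G" "set_mset z' \<subseteq> atoms G"
      "mset_prod G z = mset_prod G z'" "R (size z) (size z')"
    have c: "set_mset z \<subseteq> carrier G" "set_mset z' \<subseteq> carrier G"
      by (rule subset_trans[OF *(1) atoms_carrier], rule subset_trans[OF *(2) atoms_carrier])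
    have "image_mset f z = image_mset f z'"
    proof (rule unique_factorizationsD[OF L])
      show "mset_prod G' (image_mset f z) = mset_prod G' (image_mset f z')"
        unfolding f_mset_prod[OF c(1), symmetric] f_mset_prod[OF c(2), symmetric]
        by (rule arg_cong[OF *(3)])
    qed (use * in \<open>simp_all add: atoms_image image_mono\<close>)
    with c show "z = z'" by (rule image_mset_inj_on[OF f_inj])
  qed
next
  assume L: "unique_factorizations R G"
  show "unique_factorizations R G'"
    unfolding unique_factorizations_def
  proof (intro allI impI)
    fix z z'
    assume *: "set_mset z \<subseteq> atoms G'" "set_mset z' \<subseteq> atoms G'"
      "mset_prod G' z = mset_prod G' z'" "R (size z) (size z')"
    obtain y where y: "set_mset y \<subseteq> atoms G" "z = image_mset f y"
      by (rule image_mset_surj_on[OF *(1)[unfolded atoms_image]])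
    obtain y' where y': "set_mset y' \<subseteq> atoms G" "z' = image_mset f y'"
      by (rule image_mset_surj_on[OF *(2)[unfolded atoms_image]])
    have c: "set_mset y \<subseteq> carrier G" "set_mset y' \<subseteq> carrier G"
      by (rule subset_trans[OF y(1) atoms_carrier], rule subset_trans[OF y'(1) atoms_carrier])
    have "f (mset_prod G y) = f (mset_prod G y')"
      using *(3) unfolding f_mset_prod[OF c(1)] f_mset_prod[OF c(2)] y(2) y'(2) .
    then have "mset_prod G y = mset_prod G y'"
      using c by simp
    moreover have "R (size y) (size y')"
      using *(4) unfolding y(2) y'(2) size_image_mset .
    ultimately have "y = y'"
      by (rule unique_factorizationsD[OF L y(1) y'(1)])
    then show "z = z'" using y(2) y'(2) by simp
  qed
qed

end

section \<open>Monoids of multisets\<close>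

definition multiset_monoid :: "'p multiset set \<Rightarrow> 'p multiset monoid" where
  "multiset_monoid M = \<lparr>carrier = M, monoid.mult = (+), one = {#}\<rparr>"

lemma multiset_monoid_simps [simp]:
  "carrier (multiset_monoid M) = M"
  "x \<otimes>\<^bsub>multiset_monoid M\<^esub> y = x + y"
  "\<one>\<^bsub>multiset_monoid M\<^esub> = {#}"
  by (simp_all add: multiset_monoid_def)

lemma zero_sum_monoid_eq:
  "zero_sum_monoid G G0 = multiset_monoid {S. set_mset S \<subseteq> G0 \<and> mset_prod G S = \<one>\<^bsub>G\<^esub>}"
  by (simp add: zero_sum_monoid_def multiset_monoid_def)

text \<open>The submonoids of a free abelian monoid for which the inclusion is a divisor homomorphism.\<close>

locale saturated =
  fixes M :: "'p multiset set"
  assumes empty_in [simp]: "{#} \<in> M"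
    and plus_in: "a \<in> M \<Longrightarrow> b \<in> M \<Longrightarrow> a + b \<in> M"
    and diff_in: "a \<in> M \<Longrightarrow> b \<in> M \<Longrightarrow> a \<subseteq># b \<Longrightarrow> b - a \<in> M"
begin

abbreviation "G \<equiv> multiset_monoid M"

sublocale comm_monoid G
  by unfold_locales (auto simp: plus_in ac_simps Units_def)

lemma mset_prod_eq: "set_mset z \<subseteq> M \<Longrightarrow> mset_prod G z = \<Sum>\<^sub># z"
  by (induction z) auto

lemma Units_eq: "Units G = {{#}}"
  by (auto simp: Units_def)

text \<open>The only possible cofactor is \<open>b - a\<close>, and it lies in \<open>M\<close> by
  \<open>diff_in\<close>. So divisibility is inherited from the free monoid, and atoms are the
  minimal nonempty elements of \<open>M\<close>.\<close>

lemma divides_iff: "a \<in> M \<Longrightarrow> b \<in> M \<Longrightarrow> a divides\<^bsub>G\<^esub> b \<longleftrightarrow> a \<subseteq># b"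
  by (auto simp: factor_def intro!: bexI[of _ "b - a"] diff_in)

lemma atom_iff: "u \<in> atoms G \<longleftrightarrow> u \<in> M \<and> u \<noteq> {#} \<and> (\<forall>a\<in>M. a \<subseteq># u \<longrightarrow> a = {#} \<or> a = u)"
  unfolding atoms_def irreducible_def properfactor_def Units_eq
  by (auto simp: divides_iff)

lemma atoms_subset: "set_mset z \<subseteq> atoms G \<Longrightarrow> set_mset z \<subseteq> M"
  using atom_iff by blast

lemma unique_factorizations_sum_iff:
  "unique_factorizations R G \<longleftrightarrow>
     (\<forall>z z'. set_mset z \<subseteq> atoms G \<longrightarrow> set_mset z' \<subseteq> atoms G \<longrightarrow>
        \<Sum>\<^sub># z = \<Sum>\<^sub># z' \<longrightarrow> R (size z) (size z') \<longrightarrow> z = z')"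
  unfolding unique_factorizations_def
  by (intro all_cong1 imp_cong refl) (simp add: mset_prod_eq atoms_subset)

text \<open>Induction on the size: a nonempty proper part \<open>a\<close> of \<open>x\<close> in
  \<open>M\<close> leaves the complement \<open>x - a\<close> in \<open>M\<close>, and both are
  smaller than \<open>x\<close>.\<close>

lemma factorization_exists:
  assumes "x \<in> M"
  obtains z where "set_mset z \<subseteq> atoms G" "\<Sum>\<^sub># z = x"
proof -
  have "\<exists>z. set_mset z \<subseteq> atoms G \<and> \<Sum>\<^sub># z = x"
    using assms
  proof (induction "size x" arbitrary: x rule: less_induct)
    case less
    show ?case
    proof (cases "x = {#} \<or> x \<in> atoms G")
      case True
      then show ?thesis
        by (auto intro: exI[of _ "{#}"] exI[of _ "{#x#}"])
    next
      case False
      then obtain a where a: "a \<in> M" "a \<subseteq># x" "a \<noteq> {#}" "a \<noteq> x"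
        using less.prems by (auto simp: atom_iff)
      then have "size a < size x" "size (x - a) < size x"
        by (auto simp: mset_subset_size subset_mset.less_le size_Diff_submset nonempty_has_size)
          (metis diff_less mset_subset_size nonempty_has_size order_less_trans subset_mset.le_neq_trans)
      with less a obtain z z' where "set_mset z \<subseteq> atoms G" "\<Sum>\<^sub># z = a"
        "set_mset z' \<subseteq> atoms G" "\<Sum>\<^sub># z' = x - a"
        by (metis diff_in)
      with a show ?thesis
        by (intro exI[of _ "z + z'"]) auto
    qed
  qed
  with that show thesis by blast
qed

text \<open>Atoms are minimal, and \<open>{#p#}\<close> already is a part of
  \<open>u\<close>.\<close>

lemma atom_containing_singleton:
  "{#p#} \<in> M \<Longrightarrow> u \<in> atoms G \<Longrightarrow> p \<in># u \<Longrightarrow> u = {#p#}"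
  by (metis atom_iff mset_subset_eq_single add_mset_eq_singleton_iff multi_self_add_other_not_self)

end

section \<open>Relations between atoms under length-factoriality\<close>

context saturated
begin

text \<open>If \<open>w\<close> occurred on neither side of the non-trivial relation between
  \<open>z\<close> and \<open>z'\<close>, a combination of both relations with balanced lengths
  would contain \<open>w\<close> on one side only.\<close>

lemma nonunique_atom_in_relation:
  assumes LF: "unique_factorizations (=) G"
    and z: "set_mset z \<subseteq> atoms G" "set_mset z' \<subseteq> atoms G" "\<Sum>\<^sub># z = \<Sum>\<^sub># z'" "z \<noteq> z'"
    and y: "set_mset y \<subseteq> atoms G" "set_mset y' \<subseteq> atoms G" "\<Sum>\<^sub># y = \<Sum>\<^sub># y'"
    and w: "w \<in># y" "w \<notin># y'"
  shows "w \<in># z \<or> w \<in># z'"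
proof (rule ccontr)
  assume "\<not> (w \<in># z \<or> w \<in># z')"
  then have w0: "count z w = 0" "count z' w = 0" "count y' w = 0" "count y w > 0"
    using w by (auto simp: not_in_iff)
  have LF': "v = v'" if "set_mset v \<subseteq> atoms G" "set_mset v' \<subseteq> atoms G" "\<Sum>\<^sub># v = \<Sum>\<^sub># v'"
    "size v = size v'" for v v'
    using LF that unfolding unique_factorizations_sum_iff by blast
  have sum_repeat: "\<Sum>\<^sub># (repeat_mset n v) = repeat_mset n (\<Sum>\<^sub># v)" for n and v :: "'p multiset multiset"
    by (induction n) auto
  have set_repeat: "set_mset (repeat_mset n v) \<subseteq> set_mset v" for n and v :: "'p multiset multiset"
    by (induction n) auto
  text \<open>Multiples of two relations can be combined so that the lengths balance.\<close>
  have *: False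
    if v: "set_mset v \<subseteq> atoms G" "set_mset v' \<subseteq> atoms G" "\<Sum>\<^sub># v = \<Sum>\<^sub># v'"
      and lt: "size v' < size v" and v0: "count v w = 0" "count v' w = 0" for v v'
  proof -
    obtain d where d: "size v = size v' + d" "d > 0"
      using lt less_imp_add_positive by metis
    have "size y \<noteq> size y'"
      using LF'[of y y'] y w by blast
    then consider "size y' < size y" | "size y < size y'" by linarith
    then show False
    proof cases
      case 1
      then obtain e where e: "size y = size y' + e"
        using less_imp_add_positive by metis
      \<comment> \<open>The surpluses \<open>d\<close> and \<open>e\<close> serve as weights: both
        sides have length \<open>e * size v' + d * size y' + d * e\<close>.\<close>
      have "repeat_mset e v + repeat_mset d y' = repeat_mset e v' + repeat_mset d y"
      proof (rule LF')
        show "set_mset (repeat_mset e v + repeat_mset d y') \<subseteq> atoms G"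
          "set_mset (repeat_mset e v' + repeat_mset d y) \<subseteq> atoms G"
          using v y set_repeat unfolding set_mset_union by (meson Un_least subset_trans)+
      qed (use v y in \<open>simp_all add: sum_repeat d e algebra_simps\<close>)
      then have "count (repeat_mset e v + repeat_mset d y') w
          = count (repeat_mset e v' + repeat_mset d y) w" by simp
      with d w0 v0 have "count y w = 0" by simp
      with w show False by (simp add: count_eq_zero_iff)
    next
      case 2
      then obtain e where e: "size y' = size y + e"
        using less_imp_add_positive by metis
      \<comment> \<open>The second relation now has its surplus on the other side, so
        \<open>y\<close> and \<open>y'\<close> change places.\<close>
      have "repeat_mset e v + repeat_mset d y = repeat_mset e v' + repeat_mset d y'"
      proof (rule LF')
        show "set_mset (repeat_mset e v + repeat_mset d y) \<subseteq> atoms G"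
          "set_mset (repeat_mset e v' + repeat_mset d y') \<subseteq> atoms G"
          using v y set_repeat unfolding set_mset_union by (meson Un_least subset_trans)+
      qed (use v y in \<open>simp_all add: sum_repeat d e algebra_simps\<close>)
      then have "count (repeat_mset e v + repeat_mset d y) w
          = count (repeat_mset e v' + repeat_mset d y') w" by simp
      with d w0 v0 have "count y w = 0" by simp
      with w show False by (simp add: count_eq_zero_iff)
    qed
  qed
  have "size z \<noteq> size z'"
    using LF'[of z z'] z by blast
  then show False
    using *[OF z(1,2,3)] *[OF z(2,1) z(3)[symmetric]] w0 by (meson linorder_neqE_nat)
qed

end

section \<open>The approximation property and factoriality\<close>

locale saturated_in_free = saturated M for M :: "'p multiset set" +
  fixes P :: "'p set"
  assumes M_subset: "a \<in> M \<Longrightarrow> set_mset a \<subseteq> P"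
begin

text \<open>Any two factorizations with the same sum turn out to coincide, whatever their lengths;
  hence the arbitrary \<open>R\<close>. With \<open>R\<close> total the conclusion is
  factoriality.\<close>

lemma approximation_imp_unique_factorizations:
  assumes LF: "unique_factorizations (=) G"
    and approx: "\<And>p Q. p \<in> P \<Longrightarrow> finite Q \<Longrightarrow> Q \<subseteq> P \<Longrightarrow> p \<notin> Q \<Longrightarrow>
      \<exists>a\<in>M. count a p = 1 \<and> (\<forall>q\<in>Q. count a q = 0)"
  shows "unique_factorizations R G"
proof -
  \<comment> \<open>Common factors cancel, so it suffices to exclude relations whose two sides share
    no atom and contain at least one.\<close>
  have disjoint: False
    if z: "set_mset z1 \<subseteq> atoms G" "set_mset z2 \<subseteq> atoms G" "\<Sum>\<^sub># z1 = \<Sum>\<^sub># z2"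
      and dis: "z1 \<inter># z2 = {#}" and u: "u \<in># z1" for z1 z2 u
  proof -
    have dis': "v \<notin># z2" if "v \<in># z1" for v
      using dis that by (metis disjunct_not_in)
    then have ne: "z1 \<noteq> z2" using u by blast
    have u_atom: "u \<in> atoms G" using z u by blast
    then obtain p where p: "p \<in># u"
      by (auto simp: atom_iff)
    define S where "S = (\<Union>v\<in>set_mset (z1 + z2). set_mset v)"
    have S: "finite S" "S \<subseteq> P"
      using z M_subset by (auto simp: S_def atom_iff subset_iff)
    have pP: "p \<in> P"
      using p u S by (auto simp: S_def)
    \<comment> \<open>\<open>a\<close> contains \<open>p\<close> once and no other prime divisor of
      the relation; the atom \<open>w\<close> of \<open>a\<close> that contains \<open>p\<close>
      inherits both properties.\<close>
    obtain a where a: "a \<in> M" "count a p = 1" "\<And>q. q \<in> S - {p} \<Longrightarrow> count a q = 0"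
      using approx[of p "S - {p}"] pP S by auto
    obtain s where s: "set_mset s \<subseteq> atoms G" "\<Sum>\<^sub># s = a"
      using factorization_exists a(1) by blast
    have "p \<in># a" using a(2) by (simp flip: count_greater_zero_iff)
    then obtain w where w: "w \<in># s" "p \<in># w"
      using s by (auto simp: in_Union_mset_iff)
    have w_atom: "w \<in> atoms G" using w s by blast
    have w_le: "w \<subseteq># a"
      using w s by (metis sum_mset.remove mset_subset_eq_add_left)
    have w_p: "count w p = 1"
      using w(2) w_le a(2) mset_subset_eq_count[OF w_le, of p] count_greater_zero_iff[of w p] by linarith
    have w_S: "count w q = 0" if "q \<in> S - {p}" for q
      using a(3)[OF that] mset_subset_eq_count[OF w_le, of q] by simp
    show False
    proof (cases "w \<in># z1 + z2")
      \<comment> \<open>Now the support of \<open>w\<close> lies in \<open>S\<close>, so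
        \<open>w\<close> is \<open>{#p#}\<close> and is the only atom containing \<open>p\<close>.
        Both sides contain \<open>p\<close>, hence share this atom.\<close>
      case True
      then have "set_mset w \<subseteq> {p}"
        using w_S by (fastforce simp: S_def not_in_iff[symmetric])
      then have "w = {#p#}"
        using w_p by (intro multiset_eqI) (auto simp: not_in_iff[symmetric])
      then have pM: "{#p#} \<in> M"
        using w_atom by (simp add: atom_iff)
      have "p \<in># \<Sum>\<^sub># z1"
        using p u by (auto simp: in_Union_mset_iff)
      then have "p \<in># \<Sum>\<^sub># z2"
        using z(3) by simp
      then obtain v where v: "v \<in># z2" "p \<in># v"
        by (auto simp: in_Union_mset_iff)
      then have "v = {#p#}" "u = {#p#}"
        using atom_containing_singleton[OF pM] z u_atom p by blast+
      with v(1) u dis' show False by blast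
    next
      case False
      \<comment> \<open>Every sequence avoiding \<open>p\<close> is part of an element of
        \<open>M\<close> avoiding \<open>p\<close>: each letter \<open>q\<close> is supplied by an
        element that contains \<open>q\<close> but not \<open>p\<close>.\<close>
      have avoid: "\<exists>b\<in>M. y \<subseteq># b \<and> p \<notin># b" if "set_mset y \<subseteq> P - {p}" for y
        using that
      proof (induction y)
        case empty
        then show ?case by (auto intro: bexI[of _ "{#}"])
      next
        case (add q y)
        then obtain b where b: "b \<in> M" "y \<subseteq># b" "p \<notin># b" by auto
        obtain c where c: "c \<in> M" "count c q = 1" "count c p = 0"
          using approx[of q "{p}"] add.prems pP by auto
        have "{#q#} \<subseteq># c"
          using c(2) by (simp flip: count_greater_zero_iff)
        then have "{#q#} + y \<subseteq># c + b"
          using b by (intro subset_mset.add_mono)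
        with b c show ?case
          by (intro bexI[of _ "c + b"]) (auto simp: plus_in not_in_iff)
      qed
      have "set_mset (w - {#p#}) \<subseteq> P - {p}"
        using w_p M_subset[of w] w_atom
        by (auto simp: atom_iff dest: in_diffD) (simp add: not_in_iff[symmetric] in_diff_count)
      then obtain b where b: "b \<in> M" "w - {#p#} \<subseteq># b" "p \<notin># b"
        using avoid by blast
      \<comment> \<open>The \<open>p\<close> of \<open>w\<close> is taken from \<open>u\<close> and
        the rest from \<open>b\<close>. So \<open>u + b\<close> has a factorization with
        \<open>w\<close> and another, \<open>add_mset u r\<close>, without it.\<close>
      have "w \<subseteq># u + b"
        using subset_mset.add_mono[OF _ b(2), of "{#p#}" u] p w(2) by simp
      then have "u + b - w \<in> M"
        using u_atom w_atom b(1) by (auto simp: atom_iff intro!: diff_in plus_in)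
      then obtain t where t: "set_mset t \<subseteq> atoms G" "\<Sum>\<^sub># t = u + b - w"
        using factorization_exists by blast
      obtain r where r: "set_mset r \<subseteq> atoms G" "\<Sum>\<^sub># r = b"
        using factorization_exists b(1) by blast
      have "w \<notin># r"
      proof
        assume "w \<in># r"
        then have "w \<subseteq># b"
          using r by (metis sum_mset.remove mset_subset_eq_add_left)
        with w(2) b(3) show False
          by (meson mset_subset_eqD)
      qed
      moreover have "w \<noteq> u" using False u by auto
      ultimately have "w \<in># z1 \<or> w \<in># z2"
        using t r u_atom w_atom \<open>w \<subseteq># u + b\<close>
        by (intro nonunique_atom_in_relation[OF LF z ne, of "add_mset w t" "add_mset u r"]) auto
      with False show False by simp
    qed
  qed
  have "z = z'"
    if z: "set_mset z \<subseteq> atoms G" "set_mset z' \<subseteq> atoms G" "\<Sum>\<^sub># z = \<Sum>\<^sub># z'" for z z'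
  proof -
    have "\<Sum>\<^sub># (z - z') + \<Sum>\<^sub># (z \<inter># z') = \<Sum>\<^sub># z" "\<Sum>\<^sub># (z' - z) + \<Sum>\<^sub># (z \<inter># z') = \<Sum>\<^sub># z'"
      by (metis diff_intersect_left_idem subset_mset.inf_le1 subset_mset.diff_add sum_mset.union,
          metis diff_intersect_right_idem subset_mset.inf_le2 subset_mset.diff_add sum_mset.union)
    then have "\<Sum>\<^sub># (z - z') = \<Sum>\<^sub># (z' - z)" using z(3) by (metis add_right_cancel)
    moreover have "set_mset (z - z') \<subseteq> atoms G" "set_mset (z' - z) \<subseteq> atoms G"
      using z by (meson in_diffD subset_eq)+
    moreover have "(z - z') \<inter># (z' - z) = {#}"
      by (rule multiset_eqI) auto
    ultimately have "\<And>u. u \<notin># z - z'" "\<And>u. u \<notin># z' - z"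
      using disjoint by (metis subset_mset.inf_commute)+
    then have "z - z' = {#}" "z' - z = {#}"
      by (meson multiset_nonemptyE)+
    then show ?thesis
      by (metis Diff_eq_empty_iff_mset subset_mset.antisym)
  qed
  then show ?thesis
    unfolding unique_factorizations_sum_iff by blast
qed

end

section \<open>Sequences whose classes multiply to one\<close>

text \<open>Sequences over \<open>P\<close> rather than over \<open>C\<close>, since several
  elements of \<open>P\<close> may share a class. With \<open>cls\<close> the identity these are the
  usual zero-sum sequences.\<close>

definition zero_sums :: "('c, 'm) monoid_scheme \<Rightarrow> 'p set \<Rightarrow> ('p \<Rightarrow> 'c) \<Rightarrow> 'p multiset set" where
  "zero_sums C P cls =
     {x. set_mset x \<subseteq> P \<and> mset_prod C (image_mset cls x) = \<one>\<^bsub>C\<^esub>}"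

locale class_map = C: comm_group C for C (structure) +
  fixes P :: "'p set" and cls :: "'p \<Rightarrow> 'a"
  assumes cls_closed [simp]: "p \<in> P \<Longrightarrow> cls p \<in> carrier C"
begin

abbreviation "M \<equiv> zero_sums C P cls"

lemma set_cls: "set_mset x \<subseteq> P \<Longrightarrow> set_mset (image_mset cls x) \<subseteq> carrier C"
  by auto

sublocale saturated M
proof
  show "{#} \<in> M"
    by (simp add: zero_sums_def)
next
  fix a b
  assume ab: "a \<in> M" "b \<in> M"
  then show "a + b \<in> M"
    by (auto simp: zero_sums_def C.mset_prod_add[OF set_cls set_cls])
  assume "a \<subseteq># b"
  then obtain c where c: "b = a + c"
    by (auto simp: mset_subset_eq_exists_conv)
  have s: "set_mset a \<subseteq> P" "set_mset c \<subseteq> P"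
    using ab c by (auto simp: zero_sums_def)
  \<comment> \<open>Cancelling the product over \<open>a\<close> in \<open>C\<close> leaves product
    one over \<open>c\<close>.\<close>
  show "b - a \<in> M"
    using ab s C.mset_prod_closed[OF set_cls[OF s(2)]]
    by (simp add: c zero_sums_def C.mset_prod_add[OF set_cls set_cls, OF s])
qed

sublocale saturated_in_free M P
  by unfold_locales (simp add: zero_sums_def)

lemma singleton_in_iff: "{#p#} \<in> M \<longleftrightarrow> p \<in> P \<and> cls p = \<one>"
  by (auto simp: zero_sums_def)

lemma pair_in_iff: "{#p, q#} \<in> M \<longleftrightarrow> p \<in> P \<and> q \<in> P \<and> cls p \<otimes> cls q = \<one>"
  by (auto simp: zero_sums_def)

lemma triple_in_iff:
  "{#p, q, r#} \<in> M \<longleftrightarrow> p \<in> P \<and> q \<in> P \<and> r \<in> P \<and> cls p \<otimes> (cls q \<otimes> cls r) = \<one>"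
  by (auto simp: zero_sums_def)

lemma replicate_in_iff:
  assumes "p \<in> P"
  shows "replicate_mset n p \<in> M \<longleftrightarrow> cls p [^] n = \<one>"
proof -
  have "mset_prod C (replicate_mset n (cls p)) = cls p [^] n"
    using assms by (cases "n = 0") (simp_all add: mset_prod_def)
  with assms show ?thesis
    by (auto simp: zero_sums_def image_replicate_mset)
qed

text \<open>A sequence of length at most three of non-trivial classes is an atom once it lies in \<open>M\<close>: a
  proper splitting would contain a part of length one.\<close>

lemma short_atom:
  assumes "u \<in> M" "u \<noteq> {#}" "size u \<le> 3" "\<And>p. p \<in># u \<Longrightarrow> cls p \<noteq> \<one>"
  shows "u \<in> atoms G"
proof -
  have "a = {#} \<or> a = u" if a: "a \<in> M" "a \<subseteq># u" for a
  proof (rule ccontr)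
    assume ne: "\<not> (a = {#} \<or> a = u)"
    obtain c where c: "u = a + c"
      using a(2) by (auto simp: mset_subset_eq_exists_conv)
    have "c \<in> M"
      using diff_in[OF a(1) assms(1) a(2)] c by simp
    moreover have "size a \<noteq> 0" "size c \<noteq> 0" "size a + size c \<le> 3"
      using ne c assms(3) by auto
    then have "size a = 1 \<or> size c = 1" by linarith
    ultimately obtain b where "b \<in> M" "size b = 1" "b \<subseteq># u"
      using a c by auto
    moreover from this obtain p where "b = {#p#}"
      using size_1_singleton_mset by blast
    ultimately have "{#p#} \<in> M" "p \<in># u" by auto
    then show False
      using assms(4) by (simp add: singleton_in_iff)
  qed
  with assms show ?thesis
    by (simp add: atom_iff)
qed

lemma pair_atom:
  assumes "p \<in> P" "q \<in> P" "cls p \<otimes> cls q = \<one>" "cls p \<noteq> \<one>"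
  shows "{#p, q#} \<in> atoms G"
  using assms by (intro short_atom) (auto simp: pair_in_iff)

lemma triple_atom:
  assumes "p \<in> P" "q \<in> P" "r \<in> P" "cls p \<otimes> (cls q \<otimes> cls r) = \<one>"
    "cls p \<noteq> \<one>" "cls q \<noteq> \<one>" "cls r \<noteq> \<one>"
  shows "{#p, q, r#} \<in> atoms G"
  using assms by (intro short_atom) (auto simp: triple_in_iff)

end

section \<open>Class groups forced by length-factoriality\<close>

locale length_factorial_class_map = class_map C P cls
  for C (structure) and P :: "'p set" and cls :: "'p \<Rightarrow> 'a" +
  assumes LF: "unique_factorizations (=) (multiset_monoid (zero_sums C P cls))"
    and surj: "g \<in> carrier C \<Longrightarrow> g \<noteq> \<one> \<Longrightarrow> \<exists>p\<in>P. cls p = g"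
begin

lemma relation_trivial:
  assumes "set_mset z \<subseteq> atoms G" "set_mset z' \<subseteq> atoms G" "\<Sum>\<^sub># z = \<Sum>\<^sub># z'" "size z = size z'"
  shows "z = z'"
  using LF assms unfolding unique_factorizations_sum_iff by blast

text \<open>Different \<open>p\<close> and \<open>q\<close> in one class \<open>g\<close> would give
  two factorizations of length two: \<open>(p p)(q q) = (p q)(p q)\<close> if \<open>g\<close> has
  order two, and otherwise \<open>(p r)(q p s) = (q r)(p p s)\<close> with \<open>r\<close> in the
  class \<open>inv g\<close> and \<open>s\<close> in the class
  \<open>inv (g \<otimes> g)\<close>.\<close>

lemma cls_inj:
  assumes "p \<in> P" "q \<in> P" "cls p = cls q" "cls p \<noteq> \<one>"
  shows "p = q"
proof (rule ccontr)
  assume "p \<noteq> q"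
  show False
  proof (cases "cls q \<otimes> cls q = \<one>")
    case True
    have "{#{#p, p#}, {#q, q#}#} = {#{#p, q#}, {#p, q#}#}"
      by (rule relation_trivial) (use True assms in \<open>auto intro!: pair_atom\<close>)
    then have "{#p, p#} \<in># {#{#p, q#}, {#p, q#}#}"
      by (metis union_single_eq_member)
    with \<open>p \<noteq> q\<close> show False by auto
  next
    case False
    let ?g = "cls q"
    have g: "?g \<in> carrier C" using assms by simp
    obtain r where r: "r \<in> P" "cls r = inv ?g"
      using surj[of "inv ?g"] assms by auto
    obtain s where s: "s \<in> P" "cls s = inv (?g \<otimes> ?g)"
      using surj[of "inv (?g \<otimes> ?g)"] assms False by auto
    have ss: "cls s \<noteq> \<one>" "?g \<otimes> (?g \<otimes> cls s) = \<one>"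
      using s g False by (auto simp flip: C.m_assoc)
    have "{#p, r#} \<in> atoms G" "{#q, r#} \<in> atoms G"
      using assms r g by (auto intro!: pair_atom)
    moreover have "{#q, p, s#} \<in> atoms G" "{#p, p, s#} \<in> atoms G"
      using assms s(1) ss by (auto intro!: triple_atom)
    ultimately have "{#{#p, r#}, {#q, p, s#}#} = {#{#q, r#}, {#p, p, s#}#}"
      by (intro relation_trivial) auto
    then have "{#p, r#} \<in># {#{#q, r#}, {#p, p, s#}#}"
      by (metis union_single_eq_member)
    with \<open>p \<noteq> q\<close> show False by auto
  qed
qed

text \<open>By \<open>surj\<close> and \<open>cls_inj\<close> each non-trivial class offers exactly
  one choice. The class \<open>\<one>\<close> may contain no element of \<open>P\<close>.\<close>

definition rep :: "'a \<Rightarrow> 'p" where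
  "rep g = (SOME p. p \<in> P \<and> cls p = g)"

lemma rep:
  assumes "g \<in> carrier C" "g \<noteq> \<one>"
  shows "rep g \<in> P" "cls (rep g) = g"
proof -
  have "rep g \<in> P \<and> cls (rep g) = g"
    unfolding rep_def by (rule someI_ex) (use surj[OF assms] in blast)
  then show "rep g \<in> P" "cls (rep g) = g" by blast+
qed

definition pair :: "'a \<Rightarrow> 'p multiset" where
  "pair g = {#rep g, rep (inv g)#}"

text \<open>Applying \<open>cls\<close> recovers the classes \<open>g\<close> and
  \<open>inv g\<close> from \<open>pair g\<close>, up to their order.\<close>

lemma pair_eqD:
  assumes "pair g = pair h" "g \<in> carrier C" "g \<noteq> \<one>" "h \<in> carrier C" "h \<noteq> \<one>"
  shows "h = g \<or> h = inv g"
proof -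
  have "image_mset cls (pair g) = image_mset cls (pair h)"
    using assms(1) by simp
  then have "{#g, inv g#} = {#h, inv h#}"
    using assms by (simp add: pair_def rep)
  moreover have "h \<in># {#h, inv h#}" by simp
  ultimately have "h \<in># {#g, inv g#}" by metis
  then show ?thesis by auto
qed

definition triple :: "'a \<Rightarrow> 'a \<Rightarrow> 'p multiset" where
  "triple g h = {#rep g, rep h, rep (inv (g \<otimes> h))#}"

text \<open>Exactly the condition that the three classes in \<open>triple g h\<close> are
  non-trivial elements of \<open>C\<close>, which makes \<open>triple g h\<close> an atom.\<close>

definition admissible :: "'a \<Rightarrow> 'a \<Rightarrow> bool" where
  "admissible g h \<longleftrightarrow> g \<in> carrier C \<and> h \<in> carrier C \<and> g \<noteq> \<one> \<and> h \<noteq> \<one> \<and> g \<otimes> h \<noteq> \<one>"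

lemma pair_is_atom: "g \<in> carrier C \<Longrightarrow> g \<noteq> \<one> \<Longrightarrow> pair g \<in> atoms G"
  unfolding pair_def by (rule pair_atom) (simp_all add: rep)

lemma triple_is_atom: "admissible g h \<Longrightarrow> triple g h \<in> atoms G"
  unfolding triple_def admissible_def
  by (rule triple_atom) (simp_all add: rep flip: C.m_assoc)

lemma admissible_inv: "admissible g h \<Longrightarrow> admissible (inv g) (inv h)"
  unfolding admissible_def by (simp add: C.inv_mult[symmetric])

text \<open>The relation \<open>(g, h, -(g + h)) + (-g, -h, g + h) = (g, -g) + (h, -h) + (g + h, -(g + h))\<close> has
  two factors on one side and three on the other. By length-factoriality any two such relations
  must be the same.\<close>

lemma pairs_eq:
  assumes "admissible g h" "admissible g' h'"
  shows "{#pair g, pair h, pair (g \<otimes> h)#} = {#pair g', pair h', pair (g' \<otimes> h')#}"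
proof -
  let ?T = "\<lambda>g h. {#triple g h, triple (inv g) (inv h)#}"
  let ?D = "\<lambda>g h. {#pair g, pair h, pair (g \<otimes> h)#}"
  have sum: "\<Sum>\<^sub># (?T a b) = \<Sum>\<^sub># (?D a b)" if "admissible a b" for a b
    using that by (simp add: pair_def triple_def admissible_def C.inv_mult)
  \<comment> \<open>Each side joins the two triples of one relation with the three pairs of the
    other, so both sides have five factors.\<close>
  have "?T g h + ?D g' h' = ?T g' h' + ?D g h"
  proof (rule relation_trivial)
    have "set_mset (?D a b) \<subseteq> atoms G" "set_mset (?T a b) \<subseteq> atoms G" if "admissible a b" for a b
      using that admissible_inv[OF that] pair_is_atom triple_is_atom by (auto simp: admissible_def)
    then show "set_mset (?T g h + ?D g' h') \<subseteq> atoms G" "set_mset (?T g' h' + ?D g h) \<subseteq> atoms G"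
      using assms by auto
  next
    have "\<Sum>\<^sub># (?T g h + ?D g' h') = \<Sum>\<^sub># (?D g h) + \<Sum>\<^sub># (?T g' h')"
      unfolding sum_mset.union sum[OF assms(1)] sum[OF assms(2)] ..
    then show "\<Sum>\<^sub># (?T g h + ?D g' h') = \<Sum>\<^sub># (?T g' h' + ?D g h)"
      unfolding sum_mset.union by (simp only: add.commute)
  qed simp
  \<comment> \<open>Pairs have size two and triples size three, so the filter isolates the
    pairs.\<close>
  then have "filter_mset (\<lambda>u. size u = 2) (?T g h + ?D g' h')
      = filter_mset (\<lambda>u. size u = 2) (?T g' h' + ?D g h)"
    by (rule arg_cong)
  then show ?thesis
    by (simp add: pair_def triple_def)
qed

text \<open>\<open>pair h'\<close> has to be one of three fixed pairs, and a pair determines its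
  class up to inversion. Six candidates remain, which bounds the group.\<close>

lemma pair_cases:
  assumes "admissible g h" "admissible g' h'"
  shows "h' \<in> {g, inv g, h, inv h, g \<otimes> h, inv (g \<otimes> h)}"
proof -
  have "pair h' \<in># {#pair g, pair h, pair (g \<otimes> h)#}"
    unfolding pairs_eq[OF assms] by simp
  then show ?thesis
    using assms pair_eqD[of _ h'] by (fastforce simp: admissible_def)
qed

end

section \<open>Length-factoriality and small class groups\<close>

lemma (in comm_group) klein_fourI:
  assumes gh: "g \<in> carrier G" "h \<in> carrier G" "g \<noteq> \<one>" "h \<noteq> \<one>" "g \<noteq> h"
    and sq: "g \<otimes> g = \<one>" "h \<otimes> h = \<one>"
    and carrier: "carrier G = {\<one>, g, h, g \<otimes> h}"
  shows "elementary_2_group_rank_two G"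
proof -
  let ?Z = "integer_mod_group 2"
  let ?k = "g \<otimes> h"
  \<comment> \<open>Coordinates of \<open>x\<close> in the basis \<open>g\<close>, \<open>h\<close>
    over the field with two elements.\<close>
  define f :: "'a \<Rightarrow> int \<times> int" where
    "f x = (if x = g \<or> x = ?k then 1 else 0, if x = h \<or> x = ?k then 1 else 0)" for x
  have k: "?k \<in> carrier G" "?k \<noteq> \<one>" "?k \<noteq> g" "?k \<noteq> h"
    using gh sq by (auto, metis l_cancel)
  have g_gh: "g \<otimes> ?k = h"
    using gh sq by (simp flip: m_assoc)
  have h_gh: "h \<otimes> ?k = g"
    using gh sq by (metis m_assoc m_comm r_one)
  have table: "h \<otimes> g = ?k" "?k \<otimes> g = h" "?k \<otimes> h = g" "?k \<otimes> ?k = \<one>"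
    using gh k g_gh h_gh sq by (metis m_comm, metis m_comm, metis m_comm, metis m_assoc)
  have "f \<in> hom G (?Z \<times>\<times> ?Z)"
  proof (rule homI)
    fix x assume "x \<in> carrier G"
    show "f x \<in> carrier (?Z \<times>\<times> ?Z)"
      by (simp add: f_def carrier_integer_mod_group)
  next
    fix x y assume "x \<in> carrier G" "y \<in> carrier G"
    then have "x = \<one> \<or> x = g \<or> x = h \<or> x = ?k" "y = \<one> \<or> y = g \<or> y = h \<or> y = ?k"
      unfolding carrier by blast+
    then show "f (x \<otimes> y) = f x \<otimes>\<^bsub>?Z \<times>\<times> ?Z\<^esub> f y"
      by (elim disjE) (use gh k g_gh h_gh sq table in \<open>simp_all add: f_def\<close>)
  qed
  moreover have "bij_betw f (carrier G) (carrier (?Z \<times>\<times> ?Z))"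
  proof -
    have "{0..<2::int} = {0, 1}" by auto
    then have "carrier (?Z \<times>\<times> ?Z) = {(0, 0), (1, 0), (0, 1), (1, 1)}"
      by (auto simp: carrier_integer_mod_group)
    moreover have "inj_on f (carrier G)"
      using gh k unfolding carrier f_def by (auto simp: inj_on_def)
    moreover have "f ` carrier G = {(0, 0), (1, 0), (0, 1), (1, 1)}"
      using gh k unfolding carrier f_def by auto
    ultimately show ?thesis by (simp add: bij_betw_def)
  qed
  ultimately show ?thesis
    unfolding elementary_2_group_rank_two_def by (intro is_isoI[of f]) (simp add: iso_def)
qed

lemma (in comm_group) klein_fourE:
  assumes "elementary_2_group_rank_two G"
  obtains g h where "g \<in> carrier G" "h \<in> carrier G" "g \<noteq> \<one>" "h \<noteq> \<one>" "g \<noteq> h"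
    "g \<otimes> g = \<one>" "h \<otimes> h = \<one>" "carrier G = {\<one>, g, h, g \<otimes> h}"
proof -
  let ?Z = "integer_mod_group 2"
  let ?ZZ = "?Z \<times>\<times> ?Z"
  have ZZ: "group ?ZZ" by (simp add: DirProd_group)
  have "?ZZ \<cong> G"
    using assms iso_sym by (simp add: elementary_2_group_rank_two_def)
  then obtain k where k: "k \<in> iso ?ZZ G"
    by (auto simp: is_iso_def)
  have "{0..<2::int} = {0, 1}" by auto
  then have car: "carrier ?ZZ = {(0, 0), (1, 0), (0, 1), (1, 1)}"
    by (auto simp: carrier_integer_mod_group)
  have k_hom: "k \<in> hom ?ZZ G"
    using k by (simp only: iso_def mem_Collect_eq)
  have hom: "k (x \<otimes>\<^bsub>?ZZ\<^esub> y) = k x \<otimes> k y" if "x \<in> carrier ?ZZ" "y \<in> carrier ?ZZ" for x y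
    by (rule hom_mult[OF k_hom that])
  have "bij_betw k (carrier ?ZZ) (carrier G)"
    using k by (simp only: iso_def mem_Collect_eq)
  then have img: "carrier G = k ` carrier ?ZZ" and inj: "inj_on k (carrier ?ZZ)"
    by (simp_all only: bij_betw_def)
  have one: "k (0, 0) = \<one>"
    using hom_one[OF k_hom ZZ group_axioms] by simp
  \<comment> \<open>The two generators are the images of the unit vectors.\<close>
  show thesis
  proof (rule that[of "k (1, 0)" "k (0, 1)"])
    show "k (1, 0) \<otimes> k (1, 0) = \<one>" "k (0, 1) \<otimes> k (0, 1) = \<one>"
      using hom[of "(1, 0)" "(1, 0)"] hom[of "(0, 1)" "(0, 1)"] by (simp_all add: car one)
    show "carrier G = {\<one>, k (1, 0), k (0, 1), k (1, 0) \<otimes> k (0, 1)}"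
      using hom[of "(1, 0)" "(0, 1)"] unfolding img car by (simp add: one)
    show "k (1, 0) \<in> carrier G" "k (0, 1) \<in> carrier G"
      unfolding img car by simp_all
    show "k (1, 0) \<noteq> \<one>" "k (0, 1) \<noteq> \<one>" "k (1, 0) \<noteq> k (0, 1)"
      using inj unfolding car by (auto simp: inj_on_def simp flip: one)
  qed
qed

lemma (in saturated) atom_eqI: "x \<in> M \<Longrightarrow> x \<noteq> {#} \<Longrightarrow> x \<subseteq># u \<Longrightarrow> u \<in> atoms G \<Longrightarrow> u = x"
  by (auto simp: atom_iff)

context length_factorial_class_map
begin

text \<open>If \<open>g\<close> had order four, \<open>(p p p p)(q q) = (p p q)(p p q)\<close> for
  \<open>p\<close> and \<open>q\<close> in the classes \<open>g\<close> and
  \<open>g \<otimes> g\<close> would violate length-factoriality. If the fourth power of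
  \<open>g\<close> is not \<open>\<one>\<close>, then \<open>pairs_eq\<close> for
  \<open>(g, g)\<close> and \<open>(g \<otimes> g, g \<otimes> g)\<close> fails, as
  \<open>pair g\<close> occurs twice on one side and at most once on the other. This leaves order
  three.\<close>

lemma square_eq_inv:
  assumes g: "g \<in> carrier C" "g \<otimes> g \<noteq> \<one>"
  shows "g \<otimes> g = inv g"
proof (rule ccontr)
  let ?s = "g \<otimes> g"
  assume ns: "?s \<noteq> inv g"
  have g1: "g \<noteq> \<one>" using g by auto
  have s: "?s \<in> carrier C" "?s \<noteq> g" using g g1 by auto
  have cube: "g \<otimes> ?s \<noteq> \<one>" using ns g s C.inv_equality[of ?s g] C.inv_equality[of g ?s]
    by (metis C.inv_unique' C.m_comm)
  show False
  proof (cases "?s \<otimes> ?s = \<one>")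
    case True
    let ?p = "rep g" and ?q = "rep ?s"
    have r: "?p \<in> P" "cls ?p = g" "?q \<in> P" "cls ?q = ?s"
      using rep g g1 s by simp_all
    have pow: "g [^] (2::nat) = ?s" "g [^] (3::nat) = g \<otimes> ?s" "g [^] (4::nat) = ?s \<otimes> ?s"
      using g(1) by (simp_all add: eval_nat_numeral C.m_assoc)
    \<comment> \<open>A nonempty proper part is a power of \<open>?p\<close> with exponent 1, 2 or
      3, and none of these powers of \<open>g\<close> is \<open>\<one>\<close>.\<close>
    have "replicate_mset 4 ?p \<in> atoms G"
    proof -
      have "a = {#} \<or> a = replicate_mset 4 ?p" if a: "a \<in> M" "a \<subseteq># replicate_mset 4 ?p" for a
      proof -
        obtain n where n: "n \<le> 4" "a = replicate_mset n ?p"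
          using a(2) by (rule msubseteq_replicate_msetE)
        then have "g [^] n = \<one>"
          using a(1) r by (simp add: replicate_in_iff)
        moreover have "n = 0 \<or> n = 1 \<or> n = 2 \<or> n = 3 \<or> n = 4" using n(1) by linarith
        ultimately show ?thesis
          using n(2) g g1 cube pow by auto
      qed
      then show ?thesis
        using True pow r by (simp add: atom_iff replicate_in_iff)
    qed
    moreover have "{#?q, ?q#} \<in> atoms G"
      using r True g by (intro pair_atom) auto
    moreover have "{#?p, ?p, ?q#} \<in> atoms G"
      using r True g g1 by (intro triple_atom) (auto simp: C.m_assoc)
    ultimately have "{#replicate_mset 4 ?p, {#?q, ?q#}#} = {#{#?p, ?p, ?q#}, {#?p, ?p, ?q#}#}"
      by (intro relation_trivial) (auto simp: numeral_eq_Suc)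
    moreover have "{#?q, ?q#} \<in># {#replicate_mset 4 ?p, {#?q, ?q#}#}" by simp
    ultimately have "{#?q, ?q#} \<in># {#{#?p, ?p, ?q#}, {#?p, ?p, ?q#}#}"
      by (simp only:)
    then have "size {#?q, ?q#} = size {#?p, ?p, ?q#}"
      by auto
    then show False by simp
  next
    case False
    have "pair g \<noteq> pair ?s"
      using pair_eqD[of g ?s] g g1 s ns by auto
    moreover have "{#pair g, pair g, pair ?s#} = {#pair ?s, pair ?s, pair (?s \<otimes> ?s)#}"
      by (rule pairs_eq) (use g g1 s False in \<open>auto simp: admissible_def\<close>)
    then have "count {#pair g, pair g, pair ?s#} (pair g)
        = count {#pair ?s, pair ?s, pair (?s \<otimes> ?s)#} (pair g)"
      by (rule arg_cong)
    ultimately show False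
      by (auto split: if_splits)
  qed
qed

text \<open>If \<open>g \<otimes> g \<noteq> \<one>\<close>, then \<open>g\<close> has order three
  and \<open>pair_cases\<close> for \<open>(g, g)\<close> leaves only its powers. If there is no
  such \<open>g\<close>, all elements are their own inverses, and \<open>pair_cases\<close> for
  \<open>(g, h)\<close> leaves only \<open>\<one>\<close>, \<open>g\<close>, \<open>h\<close> and
  \<open>g \<otimes> h\<close>.\<close>

lemma small_class_group:
  "finite (carrier C) \<and> order C \<le> 3 \<or> elementary_2_group_rank_two C"
proof (cases "\<exists>g\<in>carrier C. g \<otimes> g \<noteq> \<one>")
  case True
  then obtain g where g: "g \<in> carrier C" "g \<otimes> g \<noteq> \<one>" by blast
  have g1: "g \<noteq> \<one>" using g by auto
  have "h \<in> {\<one>, g, inv g}" if h: "h \<in> carrier C" for h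
  proof (cases "h = \<one> \<or> g \<otimes> h = \<one>")
    case True
    then show ?thesis
      using h g by (metis C.inv_equality C.inv_inv C.m_comm insert_iff)
  next
    case False
    then have "h \<in> {g, inv g, g, inv g, g \<otimes> g, inv (g \<otimes> g)}"
      using g g1 h by (intro pair_cases) (auto simp: admissible_def)
    then show ?thesis
      using square_eq_inv[OF g] g by auto
  qed
  then have sub: "carrier C \<subseteq> {\<one>, g, inv g}" by blast
  have "card (carrier C) \<le> card {\<one>, g, inv g}"
    by (rule card_mono) (use sub in auto)
  also have "\<dots> \<le> 3" by (simp add: card_insert_if)
  finally show ?thesis
    using finite_subset[OF sub] by (simp add: order_def)
next
  case False
  then have sq: "g \<otimes> g = \<one>" if "g \<in> carrier C" for g using that by blast
  then have inv: "inv g = g" if "g \<in> carrier C" for g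
    using that C.inv_equality by blast
  show ?thesis
  proof (cases "\<exists>g h. g \<in> carrier C \<and> h \<in> carrier C \<and> g \<noteq> \<one> \<and> h \<noteq> \<one> \<and> g \<noteq> h")
    case True
    then obtain g h where gh: "g \<in> carrier C" "h \<in> carrier C" "g \<noteq> \<one>" "h \<noteq> \<one>" "g \<noteq> h" by blast
    have adm: "admissible g k" if "k \<in> carrier C" "k \<noteq> \<one>" "k \<noteq> g" for k
      using that gh inv[of k] C.inv_equality[of g k] by (auto simp: admissible_def)
    have "k \<in> {\<one>, g, h, g \<otimes> h}" if k: "k \<in> carrier C" for k
      using pair_cases[OF adm adm, of h k] gh k inv by auto
    then have "carrier C = {\<one>, g, h, g \<otimes> h}"
      using gh by blast
    then have "elementary_2_group_rank_two C"
      by (rule C.klein_fourI[OF gh sq[OF gh(1)] sq[OF gh(2)]])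
    then show ?thesis ..
  next
    case False
    then obtain g where sub: "carrier C \<subseteq> {\<one>, g}"
      by blast
    have "card (carrier C) \<le> card {\<one>, g}"
      by (rule card_mono) (use sub in auto)
    also have "\<dots> \<le> 3" by (simp add: card_insert_if)
    finally show ?thesis
      using finite_subset[OF sub] by (simp add: order_def)
  qed
qed

end

text \<open>All factors are equal, so a factorization is determined by its length.\<close>

lemma (in saturated) unique_factorizations_single_atom:
  assumes "atoms G \<subseteq> {u}"
  shows "unique_factorizations (=) G"
  unfolding unique_factorizations_def
proof (intro allI impI)
  fix z z'
  assume z: "set_mset z \<subseteq> atoms G" "set_mset z' \<subseteq> atoms G" and size: "size z = size z'"
  have "v = replicate_mset (size v) u" if "set_mset v \<subseteq> atoms G" for v
    using that assms by (intro set_mset_subset_singletonD) blast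
  with z size show "z = z'" by metis
qed

section \<open>Zero-sum sequences over small groups\<close>

context comm_group
begin

text \<open>The atoms are \<open>g g g\<close>, \<open>h h h\<close> and \<open>g h\<close>. Their
  multiplicities \<open>a\<close>, \<open>b\<close>, \<open>c\<close> are determined by the count
  \<open>3 a + c\<close> of \<open>g\<close>, the count \<open>3 b + c\<close> of \<open>h\<close>
  and the length \<open>a + b + c\<close>, a linear system with determinant 3.\<close>

lemma zero_sums_order_three:
  assumes gh: "g \<noteq> h" and carrier: "carrier G = {\<one>, g, h}" "g \<noteq> \<one>" "h \<noteq> \<one>"
  shows "unique_factorizations (=) (multiset_monoid (zero_sums G {g, h} (\<lambda>x. x)))"
proof -
  interpret Z: class_map G "{g, h}" "\<lambda>x. x"
    by unfold_locales (use carrier in auto)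
  have c: "g \<in> carrier G" "h \<in> carrier G" using carrier by auto
  have "g \<otimes> h \<in> {\<one>, g, h}"
    unfolding carrier(1)[symmetric] using c by simp
  then have prod: "g \<otimes> h = \<one>" using c carrier(2,3) by auto
  have "g \<otimes> g \<in> {\<one>, g, h}" "h \<otimes> h \<in> {\<one>, g, h}"
    unfolding carrier(1)[symmetric] using c by simp_all
  moreover have "g \<otimes> g \<noteq> \<one>" "h \<otimes> h \<noteq> \<one>"
    using prod gh c by (metis l_cancel, metis l_cancel m_comm)
  ultimately have sq: "g \<otimes> g = h" "h \<otimes> h = g" using c carrier(2,3) by auto
  let ?a = "{#g, g, g#}" and ?b = "{#h, h, h#}" and ?c = "{#g, h#}"
  have in_M: "?a \<in> Z.M" "?b \<in> Z.M" "?c \<in> Z.M"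
    using prod sq c by (auto simp: Z.triple_in_iff Z.pair_in_iff m_comm)
  \<comment> \<open>An atom in one letter is the third power of the letter, because both letters
    have order three.\<close>
  have pure: "u = {#x, x, x#}"
    if u: "u \<in> atoms Z.G" "set_mset u \<subseteq> {x}" and x: "x \<in> {g, h}" for u x
  proof -
    have x3: "{#x, x, x#} \<in> Z.M" using x in_M by auto
    obtain n where rep: "u = replicate_mset n x"
      using set_mset_subset_singletonD[OF u(2)] by blast
    have "u \<in> Z.M" "u \<noteq> {#}"
      using u(1) by (auto simp: Z.atom_iff)
    then have "x [^] n = \<one>" "n \<noteq> 0"
      unfolding rep Z.replicate_in_iff[OF x] by auto
    moreover have "x \<in> carrier G" "x \<noteq> \<one>" "x \<otimes> x \<noteq> \<one>"
      using x by (elim insertE; simp add: sq c carrier(2,3))+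
    then have "x [^] (1::nat) \<noteq> \<one>" "x [^] (2::nat) \<noteq> \<one>"
      by (simp_all add: numeral_2_eq_2)
    ultimately have "n \<noteq> 0" "n \<noteq> 1" "n \<noteq> 2" by auto
    then have "3 \<le> n" by linarith
    then have "replicate_mset 3 x \<subseteq># u"
      unfolding rep by (simp add: subseteq_mset_def)
    then have "{#x, x, x#} \<subseteq># u"
      by (simp add: numeral_3_eq_3)
    then show ?thesis
      using Z.atom_eqI[OF x3 _ _ u(1)] by simp
  qed
  have atoms: "u \<in> {?a, ?b, ?c}" if u: "u \<in> atoms Z.G" for u
  proof (cases "g \<in># u \<and> h \<in># u")
    case True
    then have "?c \<subseteq># u"
      using gh by (auto simp: insert_subset_eq_iff in_diff_count)
    then show ?thesis
      using Z.atom_eqI[OF in_M(3) _ _ u] by simp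
  next
    case False
    have "set_mset u \<subseteq> {g, h}"
      using u Z.M_subset by (auto simp: Z.atom_iff)
    with False have "set_mset u \<subseteq> {g} \<or> set_mset u \<subseteq> {h}" by blast
    then show ?thesis using pure[OF u] by auto
  qed
  have ne: "?a \<noteq> ?b" "?a \<noteq> ?c" "?b \<noteq> ?c"
    using gh by (auto dest: arg_cong[of _ _ set_mset])
  have count: "count (\<Sum>\<^sub># z) g = 3 * count z ?a + count z ?c \<and>
      count (\<Sum>\<^sub># z) h = 3 * count z ?b + count z ?c \<and>
      size z = count z ?a + count z ?b + count z ?c" if "set_mset z \<subseteq> atoms Z.G" for z
    using that
  proof (induction z)
    case (add u z)
    then have "u \<in> {?a, ?b, ?c}" using atoms by simp
    then show ?case
      using add gh ne by (elim insertE) auto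
  qed simp
  show ?thesis
    unfolding Z.unique_factorizations_sum_iff
  proof (intro allI impI multiset_eqI)
    fix z z' u
    assume z: "set_mset z \<subseteq> atoms Z.G" "set_mset z' \<subseteq> atoms Z.G"
      "\<Sum>\<^sub># z = \<Sum>\<^sub># z'" "size z = size z'"
    have eqs: "count z ?a = count z' ?a \<and> count z ?b = count z' ?b \<and> count z ?c = count z' ?c"
      using count[OF z(1), unfolded z(3,4)] count[OF z(2)] by (elim conjE, intro conjI) linarith+
    show "count z u = count z' u"
    proof (cases "u \<in> atoms Z.G")
      case True
      then show ?thesis using atoms[OF True] eqs by auto
    next
      case False
      then show ?thesis using z by (metis count_eq_zero_iff subsetD)
    qed
  qed
qed

text \<open>The atoms are the three squares and \<open>g h k\<close>. Adding the counts of the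
  letters and subtracting twice the length leaves the multiplicity of \<open>g h k\<close>; the
  counts then give those of the squares.\<close>

lemma zero_sums_klein_four:
  assumes gh: "g \<in> carrier G" "h \<in> carrier G" "g \<noteq> \<one>" "h \<noteq> \<one>" "g \<noteq> h"
    and sq: "g \<otimes> g = \<one>" "h \<otimes> h = \<one>" and k_def: "k = g \<otimes> h"
  shows "unique_factorizations (=) (multiset_monoid (zero_sums G {g, h, k} (\<lambda>x. x)))"
proof -
  have k: "k \<in> carrier G" "k \<noteq> \<one>" "k \<noteq> g" "k \<noteq> h"
    using gh sq unfolding k_def by (auto, metis l_cancel)
  interpret Z: class_map G "{g, h, k}" "\<lambda>x. x"
    by unfold_locales (use gh k in auto)
  have kk: "k \<otimes> k = \<one>"
    using gh sq unfolding k_def by (metis m_assoc m_closed m_comm r_one)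
  have ghk: "g \<otimes> (h \<otimes> k) = \<one>"
    using gh k kk unfolding k_def by (simp add: m_assoc)
  have "g \<otimes> k \<noteq> g \<otimes> g" "h \<otimes> k \<noteq> h \<otimes> h"
    using gh k by simp_all
  then have prods: "g \<otimes> h \<noteq> \<one>" "g \<otimes> k \<noteq> \<one>" "h \<otimes> k \<noteq> \<one>"
    using k(2) unfolding k_def sq by simp_all
  let ?a = "{#g, g#}" and ?b = "{#h, h#}" and ?c = "{#k, k#}" and ?d = "{#g, h, k#}"
  have in_M: "?a \<in> Z.M" "?b \<in> Z.M" "?c \<in> Z.M" "?d \<in> Z.M"
    using sq kk ghk by (auto simp: Z.triple_in_iff Z.pair_in_iff)
  have atoms: "u \<in> {?a, ?b, ?c, ?d}" if u: "u \<in> atoms Z.G" for u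
  proof (cases "\<exists>x\<in>{g, h, k}. count u x \<ge> 2")
    case True
    then obtain x where x: "x \<in> {g, h, k}" "count u x \<ge> 2" by blast
    then have "{#x, x#} \<subseteq># u" by (simp add: subseteq_mset_def)
    moreover have "{#x, x#} \<in> Z.M" using x in_M by auto
    ultimately have "u = {#x, x#}"
      using Z.atom_eqI[of "{#x, x#}" u] u by simp
    then show ?thesis using x by auto
  next
    case False
    have uM: "u \<in> Z.M" "u \<noteq> {#}" and sub: "set_mset u \<subseteq> {g, h, k}"
      using u Z.M_subset by (auto simp: Z.atom_iff)
    have le: "count u g \<le> 1" "count u h \<le> 1" "count u k \<le> 1"
      using False by auto
    have u_eq: "u = replicate_mset (count u g) g + replicate_mset (count u h) h + replicate_mset (count u k) k"
    proof (rule multiset_eqI)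
      fix x
      have "count u x = 0" if "x \<notin> {g, h, k}"
        using sub that by (auto simp: count_eq_zero_iff)
      then show "count u x =
          count (replicate_mset (count u g) g + replicate_mset (count u h) h + replicate_mset (count u k) k) x"
        using gh(5) k by auto
    qed
    have "count u g = 0 \<or> count u g = 1" "count u h = 0 \<or> count u h = 1"
      "count u k = 0 \<or> count u k = 1" using le by linarith+
    then have "u \<in> {{#}, {#g#}, {#h#}, {#k#}, {#g, h#}, {#g, k#}, {#h, k#}, ?d}"
      using u_eq by (elim disjE) simp_all
    \<comment> \<open>A square-free atom uses all three letters, since no single letter and no
      product of two different letters is \<open>\<one>\<close>.\<close>
    moreover have "u \<notin> {{#g#}, {#h#}, {#k#}, {#g, h#}, {#g, k#}, {#h, k#}}"
      using uM(1) gh k prods Z.singleton_in_iff Z.pair_in_iff by auto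
    ultimately show ?thesis using uM(2) by blast
  qed
  have double: "x = y" if "{#x, x#} = {#y, y#}" for x y :: 'a
    using arg_cong[OF that, of set_mset] by simp
  have ne: "?a \<noteq> ?b" "?a \<noteq> ?c" "?b \<noteq> ?c" "?a \<noteq> ?d" "?b \<noteq> ?d" "?c \<noteq> ?d"
    using gh(5) k by (auto dest: double)
  have count: "count (\<Sum>\<^sub># z) g = 2 * count z ?a + count z ?d \<and>
      count (\<Sum>\<^sub># z) h = 2 * count z ?b + count z ?d \<and>
      count (\<Sum>\<^sub># z) k = 2 * count z ?c + count z ?d \<and>
      size z = count z ?a + count z ?b + count z ?c + count z ?d" if "set_mset z \<subseteq> atoms Z.G" for z
    using that
  proof (induction z)
    case (add u z)
    then have "u \<in> {?a, ?b, ?c, ?d}" using atoms by simp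
    then show ?case
      using add gh(5) k ne by (elim insertE) auto
  qed simp
  show ?thesis
    unfolding Z.unique_factorizations_sum_iff
  proof (intro allI impI multiset_eqI)
    fix z z' u
    assume z: "set_mset z \<subseteq> atoms Z.G" "set_mset z' \<subseteq> atoms Z.G"
      "\<Sum>\<^sub># z = \<Sum>\<^sub># z'" "size z = size z'"
    have eqs: "count z ?a = count z' ?a \<and> count z ?b = count z' ?b \<and>
        count z ?c = count z' ?c \<and> count z ?d = count z' ?d"
      using count[OF z(1), unfolded z(3,4)] count[OF z(2)] by (elim conjE, intro conjI) linarith+
    show "count z u = count z' u"
    proof (cases "u \<in> atoms Z.G")
      case True
      then show ?thesis using atoms[OF True] eqs by auto
    next
      case False
      then show ?thesis using z by (metis count_eq_zero_iff subsetD)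
    qed
  qed
qed

text \<open>Apart from rank two, the cases go by the number of non-trivial elements: none leaves no
  atom, one leaves the single atom \<open>g g\<close>, two give the group of order three.\<close>

lemma small_zero_sums_length_factorial:
  assumes "finite (carrier G) \<and> order G \<le> 3 \<or> elementary_2_group_rank_two G"
  shows "unique_factorizations (=) (multiset_monoid (zero_sums G (carrier G - {\<one>}) (\<lambda>x. x)))"
  using assms
proof
  assume "elementary_2_group_rank_two G"
  then obtain g h where gh: "g \<in> carrier G" "h \<in> carrier G" "g \<noteq> \<one>" "h \<noteq> \<one>" "g \<noteq> h"
    "g \<otimes> g = \<one>" "h \<otimes> h = \<one>" and carrier: "carrier G = {\<one>, g, h, g \<otimes> h}"
    by (rule klein_fourE)
  have "g \<otimes> h \<noteq> \<one>" using gh by (metis l_cancel)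
  then have "carrier G - {\<one>} = {g, h, g \<otimes> h}"
    unfolding carrier using gh(3,4) by auto
  with zero_sums_klein_four[OF gh refl] show ?thesis by simp
next
  assume *: "finite (carrier G) \<and> order G \<le> 3"
  let ?P = "carrier G - {\<one>}"
  interpret Z: class_map G ?P "\<lambda>x. x"
    by unfold_locales auto
  have "card ?P \<le> 2"
    using conjunct2[OF *] by (simp add: order_def)
  then consider "card ?P = 0" | "card ?P = 1" | "card ?P = 2" by linarith
  then show ?thesis
  proof cases
    case 1
    then have P: "?P = {}" using * by (meson card_0_eq finite_Diff)
    have "u = {#}" if "u \<in> Z.M" for u
      using Z.M_subset[OF that] unfolding P by simp
    \<comment> \<open>There are no atoms at all; \<open>{#}\<close> is a placeholder in the bound by
      a single atom.\<close>
    then have "atoms Z.G \<subseteq> {{#}}"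
      by (auto simp: Z.atom_iff)
    then show ?thesis by (rule Z.unique_factorizations_single_atom)
  next
    case 2
    then obtain g where g: "?P = {g}" by (rule card_1_singletonE)
    then have carrier: "g \<in> carrier G" "g \<noteq> \<one>" by blast+
    have "g \<otimes> g \<noteq> g" using carrier by simp
    then have sq: "g \<otimes> g = \<one>" using g carrier m_closed[of g g] by blast
    have gP: "g \<in> ?P" using carrier by simp
    have gg: "{#g, g#} \<in> Z.M"
      using sq carrier by (simp add: Z.pair_in_iff)
    have "u = {#g, g#}" if u: "u \<in> atoms Z.G" for u
    proof -
      have uM: "u \<in> Z.M" "u \<noteq> {#}" using u by (auto simp: Z.atom_iff)
      then have "set_mset u \<subseteq> {g}" using Z.M_subset g by blast
      from set_mset_subset_singletonD[OF this] obtain n where rep: "u = replicate_mset n g" ..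
      have "n \<noteq> 0" "g [^] n = \<one>"
        using uM unfolding rep Z.replicate_in_iff[OF gP] by auto
      moreover from this have "n \<noteq> 1" using carrier by auto
      ultimately have "2 \<le> n" by linarith
      then have "replicate_mset 2 g \<subseteq># u"
        unfolding rep by (simp add: subseteq_mset_def)
      then have "{#g, g#} \<subseteq># u"
        by (simp add: numeral_2_eq_2)
      then show ?thesis
        using Z.atom_eqI[OF gg _ _ u] by simp
    qed
    then show ?thesis by (intro Z.unique_factorizations_single_atom) blast
  next
    case 3
    then obtain g h where gh: "?P = {g, h}" "g \<noteq> h" unfolding card_2_iff by blast
    then have "carrier G = {\<one>, g, h}" "g \<noteq> \<one>" "h \<noteq> \<one>"
      by blast+
    from zero_sums_order_three[OF gh(2) this] show ?thesis
      by (simp only: gh(1))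
  qed
qed

end

section \<open>Splitting off the primes\<close>

context saturated
begin

text \<open>Every \<open>{#p#}\<close> in \<open>M\<close> is a prime element of \<open>M\<close>,
  and such primes are to be split off. For the image of a divisor theory the remaining part is a
  copy of \<open>H\<^sup>*\<close>.\<close>

definition prime_free :: "'p multiset set" where
  "prime_free = {x \<in> M. \<forall>p\<in>#x. {#p#} \<notin> M}"

lemma prime_free_saturated: "saturated prime_free"
  by unfold_locales (auto simp: prime_free_def plus_in diff_in dest: in_diffD)

interpretation S: saturated prime_free
  by (rule prime_free_saturated)

lemma prime_free_atomI: "u \<in> atoms G \<Longrightarrow> u \<in> prime_free \<Longrightarrow> u \<in> atoms S.G"
  unfolding atom_iff S.atom_iff by (auto simp: prime_free_def)

lemma atom_cases:
  assumes "u \<in> atoms G"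
  obtains (prime) p where "{#p#} \<in> M" "u = {#p#}" | (free) "u \<in> prime_free"
  using assms atom_containing_singleton[OF _ assms] by (auto simp: prime_free_def atom_iff)

text \<open>By \<open>atom_containing_singleton\<close> the only factor that can contain
  \<open>p\<close> is \<open>{#p#}\<close> itself.\<close>

lemma count_singleton_factor:
  assumes p: "{#p#} \<in> M" and z: "set_mset z \<subseteq> atoms G"
  shows "count z {#p#} = count (\<Sum>\<^sub># z) p"
  using z
proof (induction z)
  case (add u z)
  show ?case
  proof (cases "p \<in># u")
    case True
    then have "u = {#p#}" using atom_containing_singleton[OF p] add.prems by simp
    with add show ?thesis by simp
  next
    case False
    then have "count u p = 0" "u \<noteq> {#p#}" by (auto simp: count_eq_zero_iff)
    with add show ?thesis by simp
  qed
qed simp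

text \<open>The multiplicities of the atoms \<open>{#p#}\<close> are read off from the sum. Removing
  them from both factorizations leaves prime-free ones with equal sums and equal lengths.\<close>

lemma length_factorial_if_prime_free:
  assumes "unique_factorizations (=) (multiset_monoid prime_free)"
  shows "unique_factorizations (=) G"
  unfolding unique_factorizations_sum_iff
proof (intro allI impI)
  fix z z'
  assume z: "set_mset z \<subseteq> atoms G" "set_mset z' \<subseteq> atoms G" "\<Sum>\<^sub># z = \<Sum>\<^sub># z'" "size z = size z'"
  let ?F = "filter_mset (\<lambda>u. u \<in> prime_free)" and ?N = "filter_mset (\<lambda>u. u \<notin> prime_free)"
  have N: "?N z = ?N z'"
  proof (rule multiset_eqI)
    fix u
    show "count (?N z) u = count (?N z') u"
    proof (cases "u \<in> atoms G")
      case True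
      then show ?thesis
        by (cases rule: atom_cases) (use z in \<open>auto simp: count_singleton_factor\<close>)
    next
      case False
      then have "u \<notin># z" "u \<notin># z'" using z by blast+
      then show ?thesis by (simp add: not_in_iff)
    qed
  qed
  have split: "v = ?F v + ?N v" for v by (rule multiset_partition)
  have "?F z = ?F z'"
  proof -
    have "\<Sum>\<^sub># (?F z) + \<Sum>\<^sub># (?N z) = \<Sum>\<^sub># (?F z') + \<Sum>\<^sub># (?N z)"
      using z(3) N split sum_mset.union by metis
    then have "\<Sum>\<^sub># (?F z) = \<Sum>\<^sub># (?F z')" by simp
    moreover have "size (?F z) + size (?N z) = size (?F z') + size (?N z)"
      using z(4) N split size_union by metis
    then have "size (?F z) = size (?F z')" by simp
    moreover have "set_mset (?F z) \<subseteq> atoms S.G" "set_mset (?F z') \<subseteq> atoms S.G"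
      using z prime_free_atomI by auto
    ultimately show ?thesis
      using assms unfolding S.unique_factorizations_sum_iff by blast
  qed
  with N split show "z = z'" by metis
qed

end

lemma (in class_map) prime_free_iff: "x \<in> prime_free \<longleftrightarrow> x \<in> M \<and> (\<forall>p\<in>#x. cls p \<noteq> \<one>)"
  using M_subset by (auto simp: prime_free_def singleton_in_iff)

text \<open>By \<open>surj\<close> and \<open>cls_inj\<close>, \<open>cls\<close> is a bijection
  from the letters of non-trivial class onto the non-trivial classes, so the map merely renames
  letters.\<close>

lemma (in length_factorial_class_map) prime_free_iso:
  "image_mset cls \<in> iso (multiset_monoid prime_free) (zero_sum_monoid C (carrier C - {\<one>}))"
proof -
  let ?Q = "{p \<in> P. cls p \<noteq> \<one>}"
  have sub: "set_mset x \<subseteq> ?Q" if "x \<in> prime_free" for x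
    using that M_subset by (auto simp: prime_free_iff)
  have inj: "inj_on cls ?Q"
    by (rule inj_onI) (use cls_inj in auto)
  have img: "cls ` ?Q = carrier C - {\<one>}"
    using surj by (auto simp: image_iff)
  have maps: "image_mset cls x \<in> carrier (zero_sum_monoid C (carrier C - {\<one>}))"
    if "x \<in> prime_free" for x
  proof -
    have "x \<in> M" using that by (simp add: prime_free_iff)
    then show ?thesis
      using sub[OF that] by (auto simp: zero_sum_monoid_def zero_sums_def)
  qed
  have "inj_on (image_mset cls) prime_free"
    by (rule inj_onI) (use image_mset_inj_on[OF inj] sub in blast)
  moreover have "y \<in> image_mset cls ` prime_free"
    if y: "y \<in> carrier (zero_sum_monoid C (carrier C - {\<one>}))" for y
  proof -
    have y': "set_mset y \<subseteq> cls ` ?Q" "mset_prod C y = \<one>"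
      using y unfolding img by (auto simp: zero_sum_monoid_def)
    obtain x where x: "set_mset x \<subseteq> ?Q" "y = image_mset cls x"
      by (rule image_mset_surj_on[OF y'(1)])
    with y'(2) have "x \<in> prime_free"
      unfolding prime_free_iff by (auto simp: zero_sums_def)
    with x show ?thesis by blast
  qed
  ultimately have "bij_betw (image_mset cls) prime_free (carrier (zero_sum_monoid C (carrier C - {\<one>})))"
    using maps by (auto simp: bij_betw_def)
  then show ?thesis
    using maps by (auto simp: iso_def hom_def zero_sum_monoid_def)
qed

section \<open>The image of a divisor theory\<close>

locale krull_divisor_theory = comm_monoid_cancel H for H (structure) +
  fixes P :: "'p set" and \<phi> :: "'a set \<Rightarrow> 'p multiset"
  assumes divisor_theory: "divisor_theory (red H) (free_monoid P) \<phi>"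
begin

abbreviation coset :: "'a \<Rightarrow> 'a set" where
  "coset a \<equiv> a <# Units H"

lemma coset_mult:
  assumes "a \<in> carrier H" "b \<in> carrier H"
  shows "coset a <#> coset b = coset (a \<otimes> b)"
proof (intro equalityI subsetI)
  fix x assume "x \<in> coset a <#> coset b"
  then obtain u v where uv: "u \<in> Units H" "v \<in> Units H" "x = (a \<otimes> u) \<otimes> (b \<otimes> v)"
    by (auto simp: set_mult_def l_coset_def)
  then have "x = (a \<otimes> b) \<otimes> (u \<otimes> v)"
    using assms Units_closed by (simp add: m_ac)
  then show "x \<in> coset (a \<otimes> b)"
    using uv by (auto simp: l_coset_def)
next
  fix x assume "x \<in> coset (a \<otimes> b)"
  then obtain u where u: "u \<in> Units H" "x = (a \<otimes> b) \<otimes> u"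
    by (auto simp: l_coset_def)
  then have "x = (a \<otimes> \<one>) \<otimes> (b \<otimes> u)"
    using assms Units_closed by (simp add: m_assoc)
  moreover have "a \<otimes> \<one> \<in> coset a" "b \<otimes> u \<in> coset b"
    using u(1) Units_one_closed unfolding l_coset_def by blast+
  ultimately show "x \<in> coset a <#> coset b"
    unfolding set_mult_def by blast
qed

lemma coset_one: "coset \<one> = Units H"
  using Units_closed by (auto simp: l_coset_def)

lemma self_in_coset: "a \<in> carrier H \<Longrightarrow> a \<in> coset a"
  unfolding l_coset_def using Units_one_closed by force

lemma coset_mult_unit:
  assumes "a \<in> carrier H" "u \<in> Units H"
  shows "coset (a \<otimes> u) = coset a"
proof -
  have "coset u = Units H"
  proof (intro equalityI subsetI)
    fix v assume v: "v \<in> Units H"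
    have "v = u \<otimes> (inv u \<otimes> v)"
      using v assms(2) by (simp add: Units_closed flip: m_assoc)
    moreover have "inv u \<otimes> v \<in> Units H" using v assms(2) by simp
    ultimately show "v \<in> coset u" unfolding l_coset_def by blast
  qed (use assms(2) in \<open>auto simp: l_coset_def\<close>)
  then have "coset (a \<otimes> u) = coset a <#> coset \<one>"
    using coset_mult[of a u] assms by (simp add: coset_one Units_closed)
  then show ?thesis
    using coset_mult[of a \<one>] assms by simp
qed

lemma red_simps:
  "carrier (red H) = coset ` carrier H"
  "A \<otimes>\<^bsub>red H\<^esub> B = A <#> B"
  "\<one>\<^bsub>red H\<^esub> = coset \<one>"
  by (simp_all add: red_def coset_one)

lemma red_comm_monoid: "comm_monoid (red H)"
  by (rule comm_monoidI) (auto simp: red_simps coset_mult m_ac)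

sublocale red: comm_monoid "red H"
  by (rule red_comm_monoid)

text \<open>Pullback of \<open>\<phi>\<close> to \<open>H\<close>, which allows working with
  elements instead of cosets.\<close>

definition \<psi> :: "'a \<Rightarrow> 'p multiset" where
  "\<psi> a = \<phi> (coset a)"

lemma phi_hom: "\<phi> \<in> hom (red H) (free_monoid P)"
  using divisor_theory by (simp add: divisor_theory_def divisor_hom_def)

lemma psi_subset: "a \<in> carrier H \<Longrightarrow> set_mset (\<psi> a) \<subseteq> P"
  using phi_hom by (auto simp: hom_def \<psi>_def red_simps free_monoid_def)

lemma psi_mult: "a \<in> carrier H \<Longrightarrow> b \<in> carrier H \<Longrightarrow> \<psi> (a \<otimes> b) = \<psi> a + \<psi> b"
  using phi_hom by (simp add: hom_def \<psi>_def red_simps free_monoid_def coset_mult)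

lemma psi_one [simp]: "\<psi> \<one> = {#}"
  using divisor_theory
  by (simp add: divisor_theory_def divisor_hom_def \<psi>_def red_simps free_monoid_def)

text \<open>The divisor homomorphism turns inclusion into divisibility of cosets; absorbing a unit
  into the cofactor gives divisibility in \<open>H\<close>.\<close>

lemma psi_le_iff:
  assumes "a \<in> carrier H" "b \<in> carrier H"
  shows "\<psi> a \<subseteq># \<psi> b \<longleftrightarrow> a divides b"
proof
  assume "\<psi> a \<subseteq># \<psi> b"
  then have "\<psi> b = \<psi> a + (\<psi> b - \<psi> a)" by simp
  moreover have "set_mset (\<psi> b - \<psi> a) \<subseteq> P"
    using psi_subset[OF assms(2)] by (auto dest: in_diffD)
  ultimately have "\<phi> (coset a) divides\<^bsub>free_monoid P\<^esub> \<phi> (coset b)"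
    unfolding factor_def free_monoid_def \<psi>_def by auto
  then have "coset a divides\<^bsub>red H\<^esub> coset b"
    using divisor_theory assms by (simp add: divisor_theory_def divisor_hom_def red_simps)
  then obtain c where c: "c \<in> carrier H" "coset b = coset (a \<otimes> c)"
    using assms by (auto simp: factor_def red_simps coset_mult)
  then obtain u where "u \<in> Units H" "b = (a \<otimes> c) \<otimes> u"
    using self_in_coset[OF assms(2)] by (auto simp: l_coset_def)
  then show "a divides b"
    using assms c Units_closed by (intro dividesI[of "c \<otimes> u"]) (auto simp: m_assoc)
next
  assume "a divides b"
  then show "\<psi> a \<subseteq># \<psi> b"
    using assms by (auto simp: factor_def psi_mult)
qed

lemma psi_eq_iff:
  assumes "a \<in> carrier H" "b \<in> carrier H"
  shows "\<psi> a = \<psi> b \<longleftrightarrow> a \<sim> b"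
  using assms by (auto simp: associated_def simp flip: psi_le_iff)

lemma coset_eq:
  assumes "a \<in> carrier H" "b \<in> carrier H" "\<psi> a = \<psi> b"
  shows "coset a = coset b"
proof -
  obtain u where "u \<in> Units H" "a = b \<otimes> u"
    using assms associatedD2[of a b] by (auto simp: psi_eq_iff)
  with assms show ?thesis by (simp add: coset_mult_unit)
qed

lemma psi_eq_empty_iff:
  assumes "a \<in> carrier H"
  shows "\<psi> a = {#} \<longleftrightarrow> a \<in> Units H"
proof -
  have "\<psi> a = {#} \<longleftrightarrow> \<psi> a \<subseteq># \<psi> \<one>" by simp
  also have "\<dots> \<longleftrightarrow> a \<in> Units H"
    unfolding psi_le_iff[OF assms one_closed]
    using assms unit_divides[of a \<one>] divides_unit[of a \<one>] by blast
  finally show ?thesis .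
qed

abbreviation "M \<equiv> \<psi> ` carrier H"

text \<open>The divisor homomorphism makes the image saturated: if \<open>x\<close> is part of
  \<open>y\<close>, the cofactor in \<open>H\<close> has image \<open>y - x\<close>.\<close>

sublocale img: saturated_in_free M P
proof
  show "{#} \<in> M" by (metis image_eqI one_closed psi_one)
next
  fix x y assume "x \<in> M" "y \<in> M"
  then obtain a b where ab: "a \<in> carrier H" "b \<in> carrier H" "x = \<psi> a" "y = \<psi> b" by blast
  then show "x + y \<in> M" by (metis image_eqI m_closed psi_mult)
  assume "x \<subseteq># y"
  then obtain c where "c \<in> carrier H" "b = a \<otimes> c"
    using ab by (auto simp: psi_le_iff factor_def)
  then show "y - x \<in> M" using ab by (simp add: psi_mult)
qed (use psi_subset in blast)

abbreviation "G \<equiv> multiset_monoid M"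

lemma phi_iso: "\<phi> \<in> iso (red H) G"
proof -
  have "inj_on \<phi> (carrier (red H))"
  proof (rule inj_onI)
    fix X Y assume XY: "X \<in> carrier (red H)" "Y \<in> carrier (red H)" "\<phi> X = \<phi> Y"
    then obtain a b where "a \<in> carrier H" "b \<in> carrier H" "X = coset a" "Y = coset b"
      unfolding red_simps by blast
    with XY(3) show "X = Y" using coset_eq[of a b] by (simp add: \<psi>_def)
  qed
  moreover have "\<phi> ` carrier (red H) = M"
    by (auto simp: red_simps \<psi>_def)
  ultimately show ?thesis
    using psi_mult by (auto simp: iso_def hom_def bij_betw_def red_simps \<psi>_def coset_mult)
qed

sublocale phi: monoid_iso "red H" G \<phi>
  by unfold_locales (rule phi_iso)

lemma factorizations_eq:
  "factorizations H a = {z. set_mset z \<subseteq> atoms (red H) \<and> mset_prod (red H) z = coset a}"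
  by (auto simp: factorizations_def factorization_monoid_def free_monoid_def)

lemma atomic: "atomic H"
  unfolding atomic_def
proof
  fix a assume a: "a \<in> carrier H"
  obtain y where y: "set_mset y \<subseteq> atoms G" "\<Sum>\<^sub># y = \<psi> a"
    using img.factorization_exists a by blast
  obtain z where z: "set_mset z \<subseteq> atoms (red H)" "y = image_mset \<phi> z"
    by (rule image_mset_surj_on[OF y(1)[unfolded phi.atoms_image]])
  have c: "set_mset z \<subseteq> carrier (red H)"
    by (rule subset_trans[OF z(1) atoms_carrier])
  have "\<phi> (mset_prod (red H) z) = \<phi> (coset a)"
    unfolding phi.f_mset_prod[OF c] z(2)[symmetric] \<psi>_def[symmetric] y(2)[symmetric]
    by (rule img.mset_prod_eq[OF img.atoms_subset[OF y(1)]])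
  then have "mset_prod (red H) z = coset a"
    using c a by (intro iffD1[OF phi.f_eq_iff] red.mset_prod_closed) (auto simp: red_simps)
  with z(1) show "factorizations H a \<noteq> {}"
    unfolding factorizations_eq by blast
qed

text \<open>Every element of \<open>red H\<close> is the coset of some \<open>a\<close>, so two
  factorizations with a common product are factorizations of one element of
  \<open>H\<close>.\<close>

lemma unique_factorizations_red_iff:
  "unique_factorizations R (red H) \<longleftrightarrow>
     (\<forall>a\<in>carrier H. \<forall>z\<in>factorizations H a. \<forall>z'\<in>factorizations H a. R (size z) (size z') \<longrightarrow> z = z')"
proof
  assume uf: "unique_factorizations R (red H)"
  show "\<forall>a\<in>carrier H. \<forall>z\<in>factorizations H a. \<forall>z'\<in>factorizations H a.
      R (size z) (size z') \<longrightarrow> z = z'"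
    using unique_factorizationsD[OF uf] unfolding factorizations_eq by force
next
  assume *: "\<forall>a\<in>carrier H. \<forall>z\<in>factorizations H a. \<forall>z'\<in>factorizations H a.
      R (size z) (size z') \<longrightarrow> z = z'"
  show "unique_factorizations R (red H)"
    unfolding unique_factorizations_def
  proof (intro allI impI)
    fix z z'
    assume z: "set_mset z \<subseteq> atoms (red H)" "set_mset z' \<subseteq> atoms (red H)"
      "mset_prod (red H) z = mset_prod (red H) z'" "R (size z) (size z')"
    have "mset_prod (red H) z \<in> carrier (red H)"
      by (rule red.mset_prod_closed, rule subset_trans[OF z(1) atoms_carrier])
    then obtain a where "a \<in> carrier H" "mset_prod (red H) z = coset a"
      unfolding red_simps by blast
    with * z show "z = z'" unfolding factorizations_eq by auto
  qed
qed

lemma length_factorial_iff: "length_factorial H \<longleftrightarrow> unique_factorizations (=) G"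
  unfolding phi.unique_factorizations_iff unique_factorizations_red_iff length_factorial_def
  using atomic by blast

text \<open>Existence comes from \<open>atomic\<close>, so what remains is uniqueness without any
  condition on lengths.\<close>

lemma factorial_iff: "factorial H \<longleftrightarrow> unique_factorizations (\<lambda>_ _. True) G"
proof -
  have "(\<exists>!z. z \<in> A) \<longleftrightarrow> (\<forall>z\<in>A. \<forall>z'\<in>A. True \<longrightarrow> z = z')" if "A \<noteq> {}" for A :: "'a set multiset set"
    using that by blast
  with atomic show ?thesis
    unfolding phi.unique_factorizations_iff unique_factorizations_red_iff factorial_def atomic_def
    by (intro ball_cong refl) blast
qed

lemma approximation_imp_factorial:
  assumes "approximation_property H P \<phi>" "length_factorial H"
  shows "factorial H"
  unfolding factorial_iff
proof (rule img.approximation_imp_unique_factorizations)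
  show "unique_factorizations (=) G"
    using assms(2) by (simp add: length_factorial_iff)
  fix p Q assume "p \<in> P" "finite Q" "Q \<subseteq> P" "p \<notin> Q"
  then show "\<exists>x\<in>M. count x p = 1 \<and> (\<forall>q\<in>Q. count x q = 0)"
    using assms(1) unfolding approximation_property_def \<psi>_def by blast
qed

section \<open>Primes and the prime-free part\<close>

lemma singleton_psi_imp_prime:
  assumes b: "b \<in> carrier H" "\<psi> b = {#q#}"
  shows "prime H b"
  unfolding prime_def
proof (intro conjI ballI impI)
  show "b \<notin> Units H" using psi_eq_empty_iff[OF b(1)] b(2) by auto
  fix x y assume xy: "x \<in> carrier H" "y \<in> carrier H" "b divides x \<otimes> y"
  then show "b divides x \<or> b divides y"
    using b by (auto simp: psi_mult simp flip: psi_le_iff)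
qed

text \<open>Here the gcd condition of a divisor theory enters: \<open>{#p#}\<close> is the gcd of
  images of elements. If \<open>u\<close> were part of all these images, it would be part of
  \<open>{#p#}\<close>.\<close>

lemma separating_element:
  assumes "p \<in> P" "set_mset u \<subseteq> P" "\<not> u \<subseteq># {#p#}"
  obtains a where "a \<in> carrier H" "p \<in># \<psi> a" "\<not> u \<subseteq># \<psi> a"
proof -
  have div: "x divides\<^bsub>free_monoid P\<^esub> y \<longleftrightarrow> x \<subseteq># y" if "set_mset y \<subseteq> P" for x y
    using that unfolding factor_def free_monoid_def
    by (auto simp: mset_subset_eq_exists_conv)
  have "{#p#} \<in> carrier (free_monoid P)"
    using assms(1) by (simp add: free_monoid_def)
  then obtain A where A: "A \<subseteq> carrier (red H)" "is_gcd_of (free_monoid P) {#p#} (\<phi> ` A)"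
    using divisor_theory unfolding divisor_theory_def by blast
  have AP: "set_mset (\<phi> X) \<subseteq> P" if "X \<in> A" for X
    using A(1) that psi_subset by (auto simp: red_simps \<psi>_def)
  have "\<exists>X\<in>A. \<not> u \<subseteq># \<phi> X"
  proof (rule ccontr)
    assume "\<not> (\<exists>X\<in>A. \<not> u \<subseteq># \<phi> X)"
    then have "\<forall>x\<in>\<phi> ` A. u divides\<^bsub>free_monoid P\<^esub> x"
      using AP div by blast
    moreover have "u \<in> carrier (free_monoid P)"
      using assms(2) by (simp add: free_monoid_def)
    ultimately have "u divides\<^bsub>free_monoid P\<^esub> {#p#}"
      using A(2) unfolding is_gcd_of_def by blast
    with div[of "{#p#}" u] assms show False by simp
  qed
  then obtain X where X: "X \<in> A" "\<not> u \<subseteq># \<phi> X" by blast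
  then obtain a where a: "a \<in> carrier H" "X = coset a"
    using A(1) unfolding red_simps by blast
  have "{#p#} divides\<^bsub>free_monoid P\<^esub> \<phi> X"
    using A(2) X(1) unfolding is_gcd_of_def by blast
  then have "{#p#} \<subseteq># \<phi> X" using div AP[OF X(1)] by blast
  then have "p \<in># \<phi> X" by simp
  with X a show thesis using that[of a] by (simp add: \<psi>_def)
qed

text \<open>Otherwise \<open>separating_element\<close> yields, for each letter \<open>r\<close> of
  \<open>\<psi> b\<close>, an element with \<open>r\<close> in its image that \<open>b\<close> does
  not divide. The prime \<open>b\<close> does not divide the product of these elements, although the
  image of the product contains \<open>\<psi> b\<close>.\<close>

lemma prime_imp_singleton_psi:
  assumes b: "b \<in> carrier H" "prime H b"
  obtains q where "\<psi> b = {#q#}"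
proof (rule ccontr)
  assume neg: "\<not> thesis"
  let ?u = "\<psi> b"
  have ne: "?u \<noteq> {#}" "\<not> b divides \<one>"
    using b psi_eq_empty_iff[OF b(1)] psi_le_iff[OF b(1) one_closed] by (auto simp: prime_def)
  have u: "set_mset ?u \<subseteq> P" using psi_subset b by blast
  have not_single: "?u \<noteq> {#r#}" for r
    using that neg by blast
  have "\<exists>a\<in>carrier H. y \<subseteq># \<psi> a \<and> \<not> b divides a" if "set_mset y \<subseteq> set_mset ?u" for y
    using that
  proof (induction y)
    case empty
    then show ?case using ne(2) by (intro bexI[of _ \<one>]) auto
  next
    case (add r y)
    then obtain a where a: "a \<in> carrier H" "y \<subseteq># \<psi> a" "\<not> b divides a" by auto
    have "\<not> ?u \<subseteq># {#r#}"
    proof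
      assume "?u \<subseteq># {#r#}"
      then obtain c where "?u + c = {#r#}" by (metis subset_mset.add_diff_inverse)
      with ne(1) not_single show False by (simp add: union_is_single)
    qed
    moreover have "r \<in> P" using add.prems u by auto
    ultimately obtain c where c: "c \<in> carrier H" "r \<in># \<psi> c" "\<not> ?u \<subseteq># \<psi> c"
      using separating_element u by blast
    then have "\<not> b divides c" using b psi_le_iff by blast
    then have "\<not> b divides c \<otimes> a"
      using a b c unfolding prime_def by blast
    moreover have "{#r#} + y \<subseteq># \<psi> c + \<psi> a"
      by (rule subset_mset.add_mono) (use a c in auto)
    ultimately show ?case
      using a c by (intro bexI[of _ "c \<otimes> a"]) (auto simp: psi_mult)
  qed
  from this[of ?u] show False
    using b psi_le_iff by blast
qed

text \<open>Injectivity and the absence of primes in the image come from uniqueness of the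
  decomposition. For surjectivity, units have empty image, and a factor from \<open>P0\<close> would
  contribute a letter \<open>q\<close> with \<open>{#q#}\<close> in \<open>M\<close>.\<close>

lemma prime_free_part_iso:
  assumes "prime_decomposition H P0 Hs"
  shows "\<psi> \<in> iso (H\<lparr>carrier := Hs\<rparr>) (multiset_monoid img.prime_free)"
proof -
  let ?f = "\<lambda>(u, f, h). u \<otimes> mset_prod H f \<otimes> h"
  let ?D = "Units H \<times> {f. set_mset f \<subseteq> P0} \<times> Hs"
  have P0: "\<And>p. p \<in> P0 \<Longrightarrow> p \<in> carrier H \<and> prime H p"
    and P0_ex: "\<And>q. q \<in> carrier H \<Longrightarrow> prime H q \<Longrightarrow> \<exists>p\<in>P0. p \<sim> q"
    and Hs: "submonoid Hs H"
    and f: "bij_betw ?f ?D (carrier H)"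
    using assms unfolding prime_decomposition_def iso_def DirProd_def free_monoid_def units_of_def
    by auto
  have Hs_carrier: "h \<in> carrier H" if "h \<in> Hs" for h
    using Hs that by (rule submonoid.mem_carrier)
  have P0_carrier: "P0 \<subseteq> carrier H" using P0 by blast
  have inj: "u = u' \<and> F = F' \<and> h = h'"
    if "u \<in> Units H" "set_mset F \<subseteq> P0" "h \<in> Hs" "u' \<in> Units H" "set_mset F' \<subseteq> P0" "h' \<in> Hs"
      "u \<otimes> mset_prod H F \<otimes> h = u' \<otimes> mset_prod H F' \<otimes> h'" for u F h u' F' h'
    using f that by (auto simp: bij_betw_def inj_on_def)
  have surj: "\<exists>u F h. u \<in> Units H \<and> set_mset F \<subseteq> P0 \<and> h \<in> Hs \<and> a = u \<otimes> mset_prod H F \<otimes> h"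
    if "a \<in> carrier H" for a
  proof -
    have "a \<in> ?f ` ?D" using f that by (simp add: bij_betw_def)
    then show ?thesis by auto
  qed
  have free: "\<psi> h \<in> img.prime_free" if h: "h \<in> Hs" for h
  proof -
    have hc: "h \<in> carrier H" using h by (rule Hs_carrier)
    have False if q: "q \<in># \<psi> h" "{#q#} \<in> M" for q
    proof -
      obtain b where b: "b \<in> carrier H" "{#q#} = \<psi> b" using q(2) by blast
      then obtain p where p: "p \<in> P0" "p \<sim> b"
        using P0_ex singleton_psi_imp_prime by metis
      have pc: "p \<in> carrier H" using p P0_carrier by blast
      have "\<psi> p = {#q#}" using p b pc psi_eq_iff by simp
      then have "p divides h" using q(1) pc hc by (simp flip: psi_le_iff)
      then obtain c where c: "c \<in> carrier H" "h = p \<otimes> c" by (auto simp: factor_def)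
      then obtain u F h' where uF: "u \<in> Units H" "set_mset F \<subseteq> P0" "h' \<in> Hs"
        "c = u \<otimes> mset_prod H F \<otimes> h'"
        using surj by blast
      have cl: "u \<in> carrier H" "set_mset F \<subseteq> carrier H" "h' \<in> carrier H"
        using uF P0_carrier Units_closed Hs_carrier by blast+
      \<comment> \<open>If \<open>p\<close> divides \<open>h\<close>, then \<open>h\<close> has two
        decompositions, one with empty \<open>P0\<close>-part and one whose \<open>P0\<close>-part
        contains \<open>p\<close>.\<close>
      have "\<one> \<otimes> mset_prod H {#} \<otimes> h = u \<otimes> mset_prod H (add_mset p F) \<otimes> h'"
        using cl pc hc c uF(4) by (simp add: m_ac)
      then have "{#} = add_mset p F"
        using inj[of \<one> "{#}" h u "add_mset p F" h'] uF p h by auto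
      then show False by simp
    qed
    then show ?thesis using hc by (auto simp: img.prime_free_def)
  qed
  have psi_inj: "h = h'" if h: "h \<in> Hs" "h' \<in> Hs" and eq: "\<psi> h = \<psi> h'" for h h'
  proof -
    have hc: "h \<in> carrier H" "h' \<in> carrier H" using h Hs_carrier by blast+
    then obtain u where u: "u \<in> Units H" "h = h' \<otimes> u"
      using eq associatedD2[of h h'] by (auto simp: psi_eq_iff)
    then have "\<one> \<otimes> mset_prod H {#} \<otimes> h = u \<otimes> mset_prod H {#} \<otimes> h'"
      using hc Units_closed by (simp add: m_comm)
    then show ?thesis
      using inj[of \<one> "{#}" h u "{#}" h'] u(1) h by auto
  qed
  have psi_surj: "\<exists>h\<in>Hs. x = \<psi> h" if x: "x \<in> img.prime_free" for x
  proof -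
    obtain a where a: "a \<in> carrier H" "x = \<psi> a" using x by (auto simp: img.prime_free_def)
    then obtain u F h where uF: "u \<in> Units H" "set_mset F \<subseteq> P0" "h \<in> Hs"
      "a = u \<otimes> mset_prod H F \<otimes> h"
      using surj by blast
    have cl: "u \<in> carrier H" "set_mset F \<subseteq> carrier H" "h \<in> carrier H"
      using uF P0_carrier Units_closed Hs_carrier by blast+
    have x_eq: "x = \<psi> (mset_prod H F) + \<psi> h"
      using cl uF a psi_eq_empty_iff[of u] by (simp add: psi_mult)
    have "F = {#}"
    proof (rule ccontr)
      assume "F \<noteq> {#}"
      then obtain p F' where F: "F = add_mset p F'" by (meson multiset_cases)
      then have p: "p \<in> carrier H" "prime H p" using uF(2) P0 by auto
      then obtain q where q: "\<psi> p = {#q#}" by (rule prime_imp_singleton_psi)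
      have "q \<in># x"
        using F cl q by (simp add: x_eq psi_mult)
      moreover have "{#q#} \<in> M" using p q by (metis imageI)
      ultimately show False using x by (auto simp: img.prime_free_def)
    qed
    with x_eq uF(3) show ?thesis by auto
  qed
  have "bij_betw \<psi> Hs img.prime_free"
    unfolding bij_betw_def inj_on_def using free psi_inj psi_surj by blast
  then show ?thesis
    using free Hs_carrier by (auto simp: iso_def hom_def psi_mult)
qed

section \<open>The class group\<close>

lemma lookup_to_frag: "Poly_Mapping.lookup (to_frag x) p = int (count x p)"
  by (induction x) (auto simp: to_frag_def lookup_add)

lemma to_frag_add: "to_frag (x + y) = to_frag x + to_frag y"
  by (simp add: to_frag_def)

lemma to_frag_inj: "to_frag x = to_frag y \<Longrightarrow> x = y"
  by (metis lookup_to_frag multiset_eqI of_nat_eq_iff)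

lemma keys_to_frag: "Poly_Mapping.keys (to_frag x) = set_mset x"
  by (auto simp: in_keys_iff lookup_to_frag)

abbreviation "N \<equiv> principal_group H \<phi>"
abbreviation "FA \<equiv> free_Abelian_group P"
abbreviation "C \<equiv> class_group H P \<phi>"

lemma principal_group_eq: "N = {to_frag x - to_frag y | x y. x \<in> M \<and> y \<in> M}"
  by (auto simp: principal_group_def red_simps \<psi>_def)

lemma principal_group_subgroup: "subgroup N FA"
proof (rule group.subgroupI[OF group_free_Abelian_group])
  have "Poly_Mapping.keys (to_frag x - to_frag y) \<subseteq> P" if "x \<in> M" "y \<in> M" for x y :: "'p multiset"
    using that img.M_subset keys_diff[of "to_frag x" "to_frag y"] by (force simp: keys_to_frag)
  then show sub: "N \<subseteq> carrier FA"
    by (auto simp: principal_group_eq)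
  show "N \<noteq> {}"
    unfolding principal_group_eq using img.empty_in by blast
  fix a assume a: "a \<in> N"
  then have "inv\<^bsub>FA\<^esub> a = - a"
    using sub by (intro inv_free_Abelian_group) (metis carrier_free_Abelian_group_iff subsetD)
  moreover have "- a \<in> N"
    using a unfolding principal_group_eq by (auto intro: minus_diff_eq)
  ultimately show "inv\<^bsub>FA\<^esub> a \<in> N" by simp
  fix b assume b: "b \<in> N"
  obtain x y x' y' where "x \<in> M" "y \<in> M" "x' \<in> M" "y' \<in> M"
    "a = to_frag x - to_frag y" "b = to_frag x' - to_frag y'"
    using a b unfolding principal_group_eq by blast
  then have "a + b = to_frag (x + x') - to_frag (y + y')" "x + x' \<in> M" "y + y' \<in> M"
    by (auto simp: to_frag_add img.plus_in)
  then show "a \<otimes>\<^bsub>FA\<^esub> b \<in> N"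
    unfolding principal_group_eq by auto
qed

text \<open>From \<open>to_frag x = to_frag a - to_frag b\<close> follows \<open>a = x + b\<close>,
  and saturation puts \<open>x\<close> into \<open>M\<close>.\<close>

lemma to_frag_in_principal_group_iff: "to_frag x \<in> N \<longleftrightarrow> x \<in> M"
proof
  assume "to_frag x \<in> N"
  then obtain a b where ab: "a \<in> M" "b \<in> M" "to_frag x = to_frag a - to_frag b"
    unfolding principal_group_eq by blast
  then have "to_frag (x + b) = to_frag a" by (simp add: to_frag_add)
  then have "a = x + b" using to_frag_inj by blast
  then show "x \<in> M" using img.diff_in[OF ab(2,1)] by simp
next
  assume "x \<in> M"
  moreover have "to_frag x = to_frag x - to_frag {#}" by (simp add: to_frag_def)
  ultimately show "to_frag x \<in> N"
    unfolding principal_group_eq using img.empty_in by blast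
qed

lemma principal_group_normal: "N \<lhd> FA"
  by (rule comm_group.subgroup_imp_normal[OF abelian_free_Abelian_group principal_group_subgroup])

lemma class_group_comm_group: "comm_group C"
  unfolding class_group_def
  by (rule comm_group.abelian_FactGroup[OF abelian_free_Abelian_group principal_group_subgroup])

lemma one_class_group: "\<one>\<^bsub>C\<^esub> = N"
  by (simp add: class_group_def)

lemma prime_class_closed: "p \<in> P \<Longrightarrow> prime_class H P \<phi> p \<in> carrier C"
  by (auto simp: prime_class_def class_group_def carrier_FactGroup)

text \<open>Multiplication in the quotient is addition of representatives, so the classes of the
  letters multiply to the coset of their sum.\<close>

lemma mset_prod_prime_class:
  assumes "set_mset x \<subseteq> P"
  shows "mset_prod C (image_mset (prime_class H P \<phi>) x) = N #>\<^bsub>FA\<^esub> to_frag x"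
  using assms
proof (induction x)
  case empty
  interpret C: comm_group C by (rule class_group_comm_group)
  have "N #>\<^bsub>FA\<^esub> 0 = N"
    using group.coset_mult_one[OF group_free_Abelian_group subgroup.subset[OF principal_group_subgroup]]
    by simp
  then show ?case
    using C.mset_prod_empty by (simp add: to_frag_def class_group_def)
next
  case (add p x)
  interpret C: comm_group C by (rule class_group_comm_group)
  have "mset_prod C (image_mset (prime_class H P \<phi>) (add_mset p x)) =
      prime_class H P \<phi> p \<otimes>\<^bsub>C\<^esub> mset_prod C (image_mset (prime_class H P \<phi>) x)"
    using add.prems prime_class_closed
    unfolding image_mset_add_mset by (intro C.mset_prod_add_mset) auto
  also have "\<dots> = (N #>\<^bsub>FA\<^esub> frag_of p) <#>\<^bsub>FA\<^esub> (N #>\<^bsub>FA\<^esub> to_frag x)"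
  proof -
    have "mset_prod C (image_mset (prime_class H P \<phi>) x) = N #>\<^bsub>FA\<^esub> to_frag x"
      using add by simp
    then show ?thesis
      by (simp only: prime_class_def) (simp add: class_group_def)
  qed
  also have "\<dots> = N #>\<^bsub>FA\<^esub> (frag_of p \<otimes>\<^bsub>FA\<^esub> to_frag x)"
    using add.prems by (intro normal.rcos_sum[OF principal_group_normal]) (auto simp: keys_to_frag)
  also have "\<dots> = N #>\<^bsub>FA\<^esub> to_frag (add_mset p x)"
    by (simp add: to_frag_def)
  finally show ?case .
qed

text \<open>The classes of a sequence multiply to one exactly if its coset is \<open>N\<close>
  itself, that is, if the sequence is principal. This makes the results on \<open>class_map\<close>
  available for \<open>M\<close>.\<close>

lemma image_eq_zero_sums: "M = zero_sums C P (prime_class H P \<phi>)"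
proof -
  have "N #>\<^bsub>FA\<^esub> to_frag x = N \<longleftrightarrow> to_frag x \<in> N" if "set_mset x \<subseteq> P" for x
    using group.coset_join1[OF group_free_Abelian_group _ _ principal_group_subgroup]
      group.coset_join2[OF group_free_Abelian_group _ principal_group_subgroup]
      that by (auto simp: keys_to_frag)
  then have "x \<in> zero_sums C P (prime_class H P \<phi>) \<longleftrightarrow> set_mset x \<subseteq> P \<and> x \<in> M" for x
    unfolding zero_sums_def mem_Collect_eq one_class_group
    by (metis mset_prod_prime_class to_frag_in_principal_group_iff)
  then show ?thesis using img.M_subset by blast
qed


section \<open>The criterion in terms of the class group\<close>

lemma class_map_prime_class:
  "class_map C P (prime_class H P \<phi>)"
  by (intro class_map.intro class_group_comm_group class_map_axioms.intro prime_class_closed)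

text \<open>Forward, the prime-free part is isomorphic both to \<open>Hs\<close> and to the zero-sum
  sequences. Backward, length-factoriality of the zero-sum sequences is carried through
  \<open>Hs\<close> to the prime-free part, and then the primes are added back.\<close>

lemma length_factorial_iff_small:
  assumes decomp: "prime_decomposition H P0 Hs"
    and surj: "\<And>g. g \<in> carrier C \<Longrightarrow> g \<noteq> \<one>\<^bsub>C\<^esub> \<Longrightarrow> \<exists>p\<in>P. prime_class H P \<phi> p = g"
  shows "length_factorial H \<longleftrightarrow>
    H\<lparr>carrier := Hs\<rparr> \<cong> zero_sum_monoid C (carrier C - {\<one>\<^bsub>C\<^esub>}) \<and>
    (finite (carrier C) \<and> order C \<le> 3 \<or> elementary_2_group_rank_two C)"
    (is "_ \<longleftrightarrow> ?Hs \<cong> ?B \<and> ?small")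
proof -
  interpret C: comm_group C by (rule class_group_comm_group)
  note psi_iso = prime_free_part_iso[OF decomp]
  show ?thesis
  proof
    assume "length_factorial H"
    then have "unique_factorizations (=) (multiset_monoid (zero_sums C P (prime_class H P \<phi>)))"
      unfolding length_factorial_iff image_eq_zero_sums .
    then interpret L: length_factorial_class_map C P "prime_class H P \<phi>"
      by (intro length_factorial_class_map.intro class_map_prime_class length_factorial_class_map_axioms.intro surj)
    have "image_mset (prime_class H P \<phi>) \<in> iso (multiset_monoid img.prime_free) ?B"
      using L.prime_free_iso unfolding image_eq_zero_sums[symmetric] .
    then have "?Hs \<cong> ?B"
      using iso_set_trans[OF psi_iso] is_isoI by blast
    then show "?Hs \<cong> ?B \<and> ?small"
      using L.small_class_group by blast
  next
    assume R: "?Hs \<cong> ?B \<and> ?small"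
    then obtain f where f: "f \<in> iso ?Hs ?B" by (auto simp: is_iso_def)
    interpret Z: class_map C "carrier C - {\<one>\<^bsub>C\<^esub>}" "\<lambda>x. x"
      by unfold_locales auto
    have B_eq: "?B = Z.G"
      by (simp add: zero_sum_monoid_eq zero_sums_def)
    have Hs_monoid: "comm_monoid ?Hs"
      using decomp submonoid_is_comm_monoid unfolding prime_decomposition_def by blast
    interpret iso_B: monoid_iso ?Hs ?B f
      by (intro monoid_iso.intro monoid_iso_axioms.intro Hs_monoid f)
        (simp add: B_eq Z.comm_monoid_axioms)
    interpret S: saturated img.prime_free
      by (rule img.prime_free_saturated)
    interpret iso_S: monoid_iso ?Hs "multiset_monoid img.prime_free" \<psi>
      by (intro monoid_iso.intro monoid_iso_axioms.intro Hs_monoid psi_iso S.comm_monoid_axioms)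
    have "unique_factorizations (=) ?B"
      unfolding B_eq by (rule C.small_zero_sums_length_factorial) (use R in blast)
    then have "unique_factorizations (=) (multiset_monoid img.prime_free)"
      unfolding iso_B.unique_factorizations_iff iso_S.unique_factorizations_iff .
    then show "length_factorial H"
      unfolding length_factorial_iff by (rule img.length_factorial_if_prime_free)
  qed
qed

end

theorem corollary1p3:
  fixes H :: "('a, 'm) monoid_scheme"
    and P :: "'p set" and \<phi> :: "'a set \<Rightarrow> 'p multiset"
    and P0 Hs :: "'a set"
  assumes "krull_monoid H"
    and "divisor_theory (red H) (free_monoid P) \<phi>"
  shows "(approximation_property H P \<phi> \<longrightarrow> (length_factorial H \<longleftrightarrow> factorial H)) \<and>
    (prime_decomposition H P0 Hs \<and>
     (\<forall>g\<in>carrier (class_group H P \<phi>). g \<noteq> \<one>\<^bsub>class_group H P \<phi>\<^esub> \<longrightarrow>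
        (\<exists>p\<in>P. prime_class H P \<phi> p = g))
     \<longrightarrow>
     (length_factorial H \<longleftrightarrow>
        H\<lparr>carrier := Hs\<rparr> \<cong>
          zero_sum_monoid (class_group H P \<phi>)
            (carrier (class_group H P \<phi>) - {\<one>\<^bsub>class_group H P \<phi>\<^esub>}) \<and>
        (finite (carrier (class_group H P \<phi>)) \<and> order (class_group H P \<phi>) \<le> 3 \<or>
         elementary_2_group_rank_two (class_group H P \<phi>))))"
proof -
  interpret H: comm_monoid_cancel H
    using assms(1) by (simp add: krull_monoid_def)
  interpret K: krull_divisor_theory H P \<phi>
    by unfold_locales (rule assms(2))
  \<comment> \<open>Uniqueness among all factorizations implies uniqueness among those of equal
    length.\<close>
  have "factorial H \<Longrightarrow> length_factorial H"
    unfolding K.factorial_iff K.length_factorial_iff unique_factorizations_def by blast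
  then have "approximation_property H P \<phi> \<longrightarrow> (length_factorial H \<longleftrightarrow> factorial H)"
    using K.approximation_imp_factorial by blast
  then show ?thesis
    by (intro conjI impI K.length_factorial_iff_small) auto
qed

end
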